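(* Let $q$ be a power of $2$ and $m\geq 2$. Let $M(x)=x^{2m}+c_{2m-1}x^{2m-1}+\cdots+c_1x+1\in\mathbb{F}_q[x]$ be a monic self-reciprocal polynomial of degree $2m$ (so $c_i=c_{2m-i}$, and necessarily $c_m=0$), such that $x-1$ divides $M(x)$ with multiplicity exactly two and all roots of $M(x)/(x-1)^2$ are simple. Let $\Phi(x)=x^{q^{2m}}+c_{2m-1}x^{q^{2m-1}}+\cdots+c_1x^q+x$ and \[L(x)=\Phi(x)+t^qx^{q^{m+1}}+tx^{q^{m-1}}\in\mathbb{F}_q(t)[x].\] Let $G$ be the Galois group of $L$ over $\mathbb{F}_q(t)$, acting on the space $V$ of roots of $L$. Then there is a prime ideal of degree $1$ in $\mathbb{F}_q[t]$ whose corresponding Frobenius class in $G$ contains an element a power of which is an orthogonal transvection (with respect to the $G$-invariant nondegenerate quadratic form $Q(\alpha)=t\alpha^{q^m+q^{m-1}}+f(\alpha)$ on $V$, where $f\in\mathbb{F}_q[x]$ is the unique polynomial with $f(0)=0$ and $f^q-f=x^{q^m}\Phi$).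
   Context: A monic polynomial $g$ of degree $d$ with $g(0)\ne0$ is self-reciprocal if $g(x)=x^dg(0)^{-1}g(x^{-1})$. The roots of $L$ form a $2m$-dimensional $\mathbb{F}_q$-space $V$ with linear $G$-action. Frobenius class: for $\mu\in\mathbb{F}_q$ and $I=(t-\mu)$, let $R$ be the integral closure of $\mathbb{F}_q[t]$ in the splitting field $E$, $J$ a prime of $R$ above $I$, $D$ its decomposition group; when the reduction of $L$ mod $I$ has nonzero $x$-coefficient, $D$ is generated by $\sigma$ with $\sigma(z)\equiv z^q\pmod J$ for $z\in R$, and the $G$-conjugacy class of $\sigma$ is the Frobenius class of $I$. An orthogonal transvection is an isometry $\sigma$ of $Q$ with minimal polynomial $(x-1)^2$ and $\sigma-I$ of rank one. *)

theory Defs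
  imports "HOL-Computational_Algebra.Computational_Algebra"
begin

definition self_reciprocal :: "'a::field poly \<Rightarrow> bool" where
  "self_reciprocal g \<longleftrightarrow> lead_coeff g = 1 \<and> coeff g 0 \<noteq> 0 \<and>
     g = smult (inverse (coeff g 0)) (reflect_poly g)"

definition const_fr :: "'a::field \<Rightarrow> 'a poly fract" where
  "const_fr c = Fract [:c:] 1"

definition poly_fr :: "'a::field poly \<Rightarrow> 'a poly fract" where
  "poly_fr P = Fract P 1"

definition tvar :: "'a::field poly fract" where
  "tvar = Fract [:0, 1:] 1"

definition linearized :: "nat \<Rightarrow> 'a::field poly \<Rightarrow> 'a poly" where
  "linearized q M = (\<Sum>i\<le>degree M. monom (coeff M i) (q ^ i))"

definition Lpoly :: "nat \<Rightarrow> nat \<Rightarrow> 'a::field poly \<Rightarrow> 'a poly fract poly" where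
  "Lpoly q m M = map_poly const_fr (linearized q M)
      + monom (tvar ^ q) (q ^ (m + 1)) + monom tvar (q ^ (m - 1))"

definition fpoly :: "nat \<Rightarrow> nat \<Rightarrow> 'a::field poly \<Rightarrow> 'a poly" where
  "fpoly q m M = (THE f. coeff f 0 = 0 \<and>
      f ^ q - f = monom 1 (q ^ m) * linearized q M)"

section \<open>Objects inside an algebraically closed field K containing F_q(t)\<close>

definition field_emb :: "('a::field \<Rightarrow> 'b::field) \<Rightarrow> bool" where
  "field_emb e \<longleftrightarrow> (\<forall>x y. e (x + y) = e x + e y) \<and> (\<forall>x y. e (x * y) = e x * e y)
      \<and> e 1 = 1 \<and> inj e"

definition alg_closed_type :: "'b::field itself \<Rightarrow> bool" where
  "alg_closed_type _ \<longleftrightarrow> (\<forall>p :: 'b poly. degree p > 0 \<longrightarrow> (\<exists>z. poly p z = 0))"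

definition is_subfield :: "'b::field set \<Rightarrow> bool" where
  "is_subfield S \<longleftrightarrow> 0 \<in> S \<and> 1 \<in> S \<and> (\<forall>x\<in>S. \<forall>y\<in>S. x + y \<in> S \<and> x - y \<in> S \<and> x * y \<in> S)
      \<and> (\<forall>x\<in>S. inverse x \<in> S)"

definition rootsL :: "('a::field poly fract \<Rightarrow> 'b::field) \<Rightarrow> nat \<Rightarrow> nat \<Rightarrow> 'a poly \<Rightarrow> 'b set" where
  "rootsL e q m M = {z. poly (map_poly e (Lpoly q m M)) z = 0}"

definition splitE :: "('a::field poly fract \<Rightarrow> 'b::field) \<Rightarrow> nat \<Rightarrow> nat \<Rightarrow> 'a poly \<Rightarrow> 'b set" where
  "splitE e q m M = \<Inter> {S. is_subfield S \<and> range e \<subseteq> S \<and> rootsL e q m M \<subseteq> S}"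

definition galG :: "('a::field poly fract \<Rightarrow> 'b::field) \<Rightarrow> nat \<Rightarrow> nat \<Rightarrow> 'a poly \<Rightarrow> ('b \<Rightarrow> 'b) set" where
  "galG e q m M = (let E = splitE e q m M in
     {\<sigma>. bij_betw \<sigma> E E \<and> (\<forall>x\<in>E. \<forall>y\<in>E. \<sigma> (x + y) = \<sigma> x + \<sigma> y \<and> \<sigma> (x * y) = \<sigma> x * \<sigma> y)
         \<and> (\<forall>c. \<sigma> (e c) = e c) \<and> (\<forall>x. x \<notin> E \<longrightarrow> \<sigma> x = x)})"

definition intR :: "('a::field poly fract \<Rightarrow> 'b::field) \<Rightarrow> nat \<Rightarrow> nat \<Rightarrow> 'a poly \<Rightarrow> 'b set" where
  "intR e q m M = {z \<in> splitE e q m M. \<exists>p :: 'a poly poly. lead_coeff p = 1 \<and>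
      poly (map_poly (e \<circ> poly_fr) p) z = 0}"

definition prime_above :: "('a::field poly fract \<Rightarrow> 'b::field) \<Rightarrow> 'b set \<Rightarrow> 'a \<Rightarrow> 'b set \<Rightarrow> bool" where
  "prime_above e R \<mu> J \<longleftrightarrow> J \<subseteq> R \<and> 0 \<in> J \<and> (\<forall>x\<in>J. \<forall>y\<in>J. x + y \<in> J \<and> - x \<in> J)
      \<and> (\<forall>r\<in>R. \<forall>x\<in>J. r * x \<in> J) \<and> 1 \<notin> J
      \<and> (\<forall>a\<in>R. \<forall>b\<in>R. a * b \<in> J \<longrightarrow> a \<in> J \<or> b \<in> J)
      \<and> (\<forall>P. e (poly_fr P) \<in> J \<longleftrightarrow> [:- \<mu>, 1:] dvd P)"

definition frobenius_at :: "('a::field poly fract \<Rightarrow> 'b::field) \<Rightarrow> nat \<Rightarrow> nat \<Rightarrow> 'a poly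
    \<Rightarrow> 'b set \<Rightarrow> ('b \<Rightarrow> 'b) \<Rightarrow> bool" where
  "frobenius_at e q m M J \<sigma> \<longleftrightarrow> \<sigma> \<in> galG e q m M \<and> \<sigma> ` J = J \<and>
      (\<forall>z\<in>intR e q m M. \<sigma> z - z ^ q \<in> J)"

definition Qform :: "('a::field poly fract \<Rightarrow> 'b::field) \<Rightarrow> nat \<Rightarrow> nat \<Rightarrow> 'a poly \<Rightarrow> 'b \<Rightarrow> 'b" where
  "Qform e q m M \<alpha> = e tvar * \<alpha> ^ (q ^ m + q ^ (m - 1))
      + poly (map_poly (e \<circ> const_fr) (fpoly q m M)) \<alpha>"

text \<open>Orthogonal transvection of the F_q-space V (scalars act via e o const_fr):
  an isometry tau of Q with (tau - 1)^2 = 0, tau ~= 1 (so minimal polynomial (x-1)^2)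
  and tau - 1 of rank one.\<close>
definition orth_transvection :: "('a::field poly fract \<Rightarrow> 'b::field) \<Rightarrow> ('b \<Rightarrow> 'b) \<Rightarrow> 'b set
    \<Rightarrow> ('b \<Rightarrow> 'b) \<Rightarrow> bool" where
  "orth_transvection e Q V \<tau> \<longleftrightarrow>
     bij_betw \<tau> V V \<and>
     (\<forall>v\<in>V. \<forall>w\<in>V. \<tau> (v + w) = \<tau> v + \<tau> w) \<and>
     (\<forall>v\<in>V. \<forall>c. \<tau> (e (const_fr c) * v) = e (const_fr c) * \<tau> v) \<and>
     (\<forall>v\<in>V. Q (\<tau> v) = Q v) \<and>
     (\<forall>v\<in>V. \<tau> (\<tau> v - v) - (\<tau> v - v) = 0) \<and>
     (\<exists>v\<in>V. \<tau> v \<noteq> v) \<and>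
     (\<exists>w\<in>V. w \<noteq> 0 \<and> {\<tau> v - v | v. v \<in> V} = {e (const_fr c) * w | c. True})"

end

theory Submission
  imports Defs "Jordan_Normal_Form.Char_Poly"
begin

text \<open>
  The prime is \<open>(t)\<close>. By Hensel's lemma each root of \<open>\<Phi>\<close> in \<open>K\<close> lifts to a root of \<open>L\<close> in
  \<open>K[[T]]\<close>, so \<open>L\<close> splits in \<open>K((T))\<close> and the splitting field \<open>E\<close> embeds into \<open>K((T))\<close> with
  \<open>t \<mapsto> T\<close>. Raising all coefficients of a Laurent series to the \<open>q\<close>-th power permutes the roots of
  \<open>L\<close>, hence restricts to an automorphism \<open>\<sigma>\<close> of \<open>E\<close>; it is a Frobenius element for the prime \<open>J\<close>
  of integral elements with vanishing constant term. Taking constant terms identifies \<open>V\<close> with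
  the roots of \<open>\<Phi>\<close>, and \<open>\<sigma>\<close> with the map \<open>F: w \<mapsto> w\<^sup>q\<close>, for which \<open>M(F) = 0\<close>. As \<open>M = (x - 1)\<^sup>2N\<close>
  with \<open>(x - 1)N\<close> squarefree, some odd \<open>k\<close> satisfies \<open>(x - 1)N | x\<^sup>k - 1\<close>, and \<open>F\<^sup>k - 1\<close> has image
  exactly \<open>F\<^sub>q\<close>, on which \<open>F\<close> is the identity. Finally \<open>Q(\<alpha>)\<^sup>q - Q(\<alpha>) = \<alpha>\<^bsup>q^m\<^esup> L(\<alpha>) = 0\<close>,
  so \<open>Q\<close> takes values in \<open>F\<^sub>q\<close> and is preserved by every automorphism over \<open>F\<^sub>q(t)\<close>.
\<close>

section \<open>Extending isomorphisms between subfields\<close>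

text \<open>A partial isomorphism between subrings of two fields is represented by its graph.\<close>

locale ring_graph =
  fixes S :: "('k::field \<times> 'l::field) set"
  assumes one: "(1, 1) \<in> S"
    and diff: "(x, y) \<in> S \<Longrightarrow> (x', y') \<in> S \<Longrightarrow> (x - x', y - y') \<in> S"
    and mult: "(x, y) \<in> S \<Longrightarrow> (x', y') \<in> S \<Longrightarrow> (x * x', y * y') \<in> S"
    and zero_iff: "(x, y) \<in> S \<Longrightarrow> x = 0 \<longleftrightarrow> y = 0"
begin

lemma zero: "(0, 0) \<in> S"
  using diff[OF one one] by simp

lemma add: "(x, y) \<in> S \<Longrightarrow> (x', y') \<in> S \<Longrightarrow> (x + x', y + y') \<in> S"
  using diff[of x y "0 - x'" "0 - y'"] diff[OF zero, of x' y'] by simp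

lemma sum: "(\<And>i. i \<in> A \<Longrightarrow> (f i, g i) \<in> S) \<Longrightarrow> (\<Sum>i\<in>A. f i, \<Sum>i\<in>A. g i) \<in> S"
  by (induction A rule: infinite_finite_induct) (auto intro: zero add)

lemma eq_iff: "(x, y) \<in> S \<Longrightarrow> (x', y') \<in> S \<Longrightarrow> x = x' \<longleftrightarrow> y = y'"
  using zero_iff[OF diff[of x y x' y']] by simp

definition polys :: "('k poly \<times> 'l poly) set" where
  "polys = {(p, p'). \<forall>i. (coeff p i, coeff p' i) \<in> S}"

lemma polysI: "(\<And>i. (coeff p i, coeff p' i) \<in> S) \<Longrightarrow> (p, p') \<in> polys"
  by (simp add: polys_def)

lemma polysD: "(p, p') \<in> polys \<Longrightarrow> (coeff p i, coeff p' i) \<in> S"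
  by (simp add: polys_def)

lemma polys_diff: "(p, p') \<in> polys \<Longrightarrow> (r, r') \<in> polys \<Longrightarrow> (p - r, p' - r') \<in> polys"
  by (simp add: polys_def diff)

lemma polys_add: "(p, p') \<in> polys \<Longrightarrow> (r, r') \<in> polys \<Longrightarrow> (p + r, p' + r') \<in> polys"
  by (simp add: polys_def add)

lemma polys_mult: "(p, p') \<in> polys \<Longrightarrow> (r, r') \<in> polys \<Longrightarrow> (p * r, p' * r') \<in> polys"
  by (simp add: polys_def coeff_mult sum mult)

lemma polys_monom: "(a, a') \<in> S \<Longrightarrow> (monom a n, monom a' n) \<in> polys"
  by (simp add: polys_def zero)

lemma polys_const: "(a, a') \<in> S \<Longrightarrow> ([:a:], [:a':]) \<in> polys"
  using polys_monom[of a a' 0] by (simp add: monom_0)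

lemma polys_zero: "(0, 0) \<in> polys"
  by (simp add: polys_def zero)

lemma polys_eq_0_iff: "(p, p') \<in> polys \<Longrightarrow> p = 0 \<longleftrightarrow> p' = 0"
  by (simp add: poly_eq_iff zero_iff[OF polysD])

lemma polys_degree: "(p, p') \<in> polys \<Longrightarrow> degree p = degree p'"
  unfolding degree_def by (simp add: zero_iff[OF polysD])

lemma polys_pCons_X: "([:0, 1:], [:0, 1:]) \<in> polys"
  using polys_monom[OF one, of 1] by (simp add: monom_altdef)

end

locale field_graph = ring_graph +
  assumes inverse: "(x, y) \<in> S \<Longrightarrow> (inverse x, inverse y) \<in> S"
begin

lemma divide: "(x, y) \<in> S \<Longrightarrow> (x', y') \<in> S \<Longrightarrow> (x / x', y / y') \<in> S"
  by (simp add: divide_inverse mult inverse)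

text \<open>Long division runs in parallel on both sides: corresponding leading coefficients have
  corresponding quotients, so each cancelled term has its partner.\<close>

lemma polys_division:
  assumes g: "(g, g') \<in> polys" "g \<noteq> 0"
  shows "(f, f') \<in> polys \<Longrightarrow> \<exists>c c' r r'. (c, c') \<in> polys \<and> (r, r') \<in> polys \<and>
    f = g * c + r \<and> f' = g' * c' + r' \<and> (r = 0 \<or> degree r < degree g)"
\<comment> \<open>This measure puts \<open>0\<close> below the nonzero constants, so cancelling the
  leading term lowers it even when \<open>g\<close> is constant.\<close>
proof (induction "if f = 0 then 0 else Suc (degree f)" arbitrary: f f' rule: less_induct)
  case less
  show ?case
  proof (cases "f = 0 \<or> degree f < degree g")
    case True
    then show ?thesis
      using less.prems polys_zero by (intro exI[of _ 0] exI[of _ f] exI[of _ f']) auto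
  next
    case False
    define n where "n = degree f - degree g"
    define a a' where "a = lead_coeff f / lead_coeff g" and "a' = lead_coeff f' / lead_coeff g'"
    have deg: "degree f = degree f'" "degree g = degree g'"
      using polys_degree less.prems g by auto
    have aS: "(a, a') \<in> S"
      unfolding a_def a'_def deg[symmetric]
      using divide polysD[OF less.prems] polysD[OF g(1)] by blast
    define h h' where "h = monom a n * g" and "h' = monom a' n * g'"
    have hS: "(h, h') \<in> polys"
      unfolding h_def h'_def by (intro polys_mult polys_monom aS g)
    have "a \<noteq> 0" using False g by (simp add: a_def)
    then have "degree h = degree f"
      using False g by (simp add: h_def degree_mult_eq degree_monom_eq n_def)
    moreover have "lead_coeff h = lead_coeff f"
      unfolding h_def lead_coeff_mult using g by (simp add: a_def degree_monom_eq[OF \<open>a \<noteq> 0\<close>, unfolded a_def])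
    ultimately have "f - h = 0 \<or> degree (f - h) < degree f"
      using degree_diff_le[of f "degree f" h] coeff_diff[of f h "degree f"]
      by (cases "degree (f - h) = degree f") (simp_all flip: leading_coeff_0_iff)
    then have "(if f - h = 0 then 0 else Suc (degree (f - h))) < (if f = 0 then 0 else Suc (degree f))"
      using False by auto
    then obtain c c' r r' where IH: "(c, c') \<in> polys" "(r, r') \<in> polys"
      "f - h = g * c + r" "f' - h' = g' * c' + r'" "r = 0 \<or> degree r < degree g"
      using less.hyps[OF _ polys_diff[OF less.prems hS]] by blast
    have "f = g * (c + monom a n) + r" "f' = g' * (c' + monom a' n) + r'"
      using IH(3,4) by (simp_all add: h_def h'_def algebra_simps)
    then show ?thesis
      using polys_add[OF IH(1) polys_monom[OF aS]] IH(2,5) by blast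
  qed
qed

end

text \<open>Closure under differences together with \<open>zero_iff\<close> already makes a graph
  single-valued and injective, so independence of the chosen fractions needs no argument of its
  own.\<close>

lemma (in ring_graph) fractions:
  "field_graph {(x / x', y / y') | x y x' y'. (x, y) \<in> S \<and> (x', y') \<in> S \<and> x' \<noteq> 0}"
    (is "field_graph ?F")
proof
  have nz: "y' \<noteq> 0" if "(x', y') \<in> S" "x' \<noteq> 0" for x' y'
    using that zero_iff by blast
  have "(1 / 1, 1 / 1) \<in> ?F" using one one_neq_zero by blast
  then show "(1, 1) \<in> ?F" by simp
  fix a b assume "(a, b) \<in> ?F"
  then obtain x y x' y' where ab: "a = x / x'" "b = y / y'" "(x, y) \<in> S" "(x', y') \<in> S" "x' \<noteq> 0"
    by auto
  show "a = 0 \<longleftrightarrow> b = 0" using ab nz zero_iff by auto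
  show "(inverse a, inverse b) \<in> ?F"
  proof (cases "x = 0")
    case True
    then have "inverse a = 0 / 1" "inverse b = 0 / 1" using ab zero_iff by auto
    moreover have "(0 / 1, 0 / 1) \<in> ?F" using zero one one_neq_zero by blast
    ultimately show ?thesis by simp
  next
    case False
    then have "inverse a = x' / x" "inverse b = y' / y" using ab by auto
    then show ?thesis using False ab by blast
  qed
  fix c d assume "(c, d) \<in> ?F"
  then obtain u v u' v' where cd: "c = u / u'" "d = v / v'" "(u, v) \<in> S" "(u', v') \<in> S" "u' \<noteq> 0"
    by auto
  have S: "(x * u' - u * x', y * v' - v * y') \<in> S" "(x * u, y * v) \<in> S" "(x' * u', y' * v') \<in> S"
    using ab cd by (auto intro!: diff mult)
  have "y' \<noteq> 0" "v' \<noteq> 0" "x' * u' \<noteq> 0" using nz ab cd by auto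
  then have "a - c = (x * u' - u * x') / (x' * u')" "b - d = (y * v' - v * y') / (y' * v')"
    "a * c = (x * u) / (x' * u')" "b * d = (y * v) / (y' * v')"
    using ab cd by (auto simp: diff_frac_eq)
  then show "(a - c, b - d) \<in> ?F" "(a * c, b * d) \<in> ?F"
    using S \<open>x' * u' \<noteq> 0\<close> by blast+
qed

text \<open>Without a root of \<open>g\<close>, all roots of \<open>A\<close> would be roots of the
  cofactor \<open>c\<close>, whose degree is too small for that many.\<close>

lemma card_roots_eq_degree_imp_factor_has_root:
  fixes A g c :: "'l::field poly"
  assumes A: "A = g * c" "A \<noteq> 0" and card: "card {z. poly A z = 0} = degree A" and "degree g > 0"
  shows "\<exists>z. poly g z = 0"
proof (rule ccontr)
  assume "\<not> ?thesis"
  then have "{z. poly A z = 0} = {z. poly c z = 0}" using A by auto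
  moreover have "c \<noteq> 0" using A by auto
  ultimately show False
    using card card_poly_roots_bound[of c] A \<open>degree g > 0\<close> by (auto simp: degree_mult_eq)
qed

section \<open>Adjoining the roots of a polynomial whose partner splits with distinct roots\<close>

context field_graph
begin

text \<open>Let \<open>g\<close> be of least degree among the nonzero polynomials over the domain
  that vanish at \<open>\<alpha>\<close>. It divides \<open>A\<close>, so its partner
  \<open>g'\<close> divides \<open>A'\<close> and has a root \<open>\<beta>\<close>; the extension
  sends \<open>\<alpha>\<close> to \<open>\<beta>\<close>.\<close>

lemma adjoin_root:
  assumes A: "(A, A') \<in> polys" "A \<noteq> 0" "card {z. poly A' z = 0} = degree A'"
    and \<alpha>: "poly A \<alpha> = 0"
  shows "\<exists>T. field_graph T \<and> S \<subseteq> T \<and> \<alpha> \<in> fst ` T"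
proof -
  define P where "P = (\<lambda>d. \<exists>g g'. (g, g') \<in> polys \<and> g \<noteq> 0 \<and> poly g \<alpha> = 0 \<and> degree g = d)"
  have "P (degree A)" unfolding P_def using A \<alpha> by blast
  then have "P (LEAST d. P d)" by (rule LeastI)
  then obtain g g' where g: "(g, g') \<in> polys" "g \<noteq> 0" "poly g \<alpha> = 0" "degree g = (LEAST d. P d)"
    unfolding P_def by blast
  have min: "f = 0" if "(f, f') \<in> polys" "poly f \<alpha> = 0" "degree f < degree g" for f f'
    using not_less_Least[of "degree f" P] that g(4) unfolding P_def by auto
  have dvd: "\<exists>c c'. (c, c') \<in> polys \<and> f = g * c \<and> f' = g' * c'" if f: "(f, f') \<in> polys" "poly f \<alpha> = 0" for f f'
  proof -
    obtain c c' r r' where d: "(c, c') \<in> polys" "(r, r') \<in> polys"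
      "f = g * c + r" "f' = g' * c' + r'" "r = 0 \<or> degree r < degree g"
      using polys_division[OF g(1,2) f(1)] by blast
    then have "poly r \<alpha> = 0" using f g by simp
    then have "r = 0" using min d by blast
    moreover from this have "r' = 0" using d polys_eq_0_iff by blast
    ultimately show ?thesis using d by auto
  qed
  obtain C C' where C: "A = g * C" "A' = g' * C'" using dvd[OF A(1) \<alpha>] by blast
  have "degree g > 0"
  proof (rule ccontr)
    assume "\<not> ?thesis"
    then obtain a where "g = [:a:]" using degree_eq_zeroE by blast
    then show False using g(2,3) by simp
  qed
  then have "degree g' > 0" using polys_degree[OF g(1)] by simp
  moreover have "A' \<noteq> 0" using A polys_eq_0_iff by blast
  ultimately obtain \<beta> where \<beta>: "poly g' \<beta> = 0"
    using card_roots_eq_degree_imp_factor_has_root[OF C(2) _ A(3)] by blast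
  have zero1: "poly f' \<beta> = 0" if "(f, f') \<in> polys" "poly f \<alpha> = 0" for f f'
    using dvd[OF that] \<beta> by auto
  \<comment> \<open>Injectivity of \<open>\<alpha> \<mapsto> \<beta>\<close>, by Euclidean descent.
    If \<open>f\<close> is nonzero at \<open>\<alpha>\<close>, write \<open>g = f * c + r\<close>;
    the induction hypothesis makes \<open>r\<close>, hence also \<open>c\<close>, vanish at
    \<open>\<alpha>\<close>, and a nonzero \<open>c\<close> would have smaller degree than
    \<open>g\<close>.\<close>
  have nz: "poly f \<alpha> = 0" if "(f, f') \<in> polys" "poly f' \<beta> = 0" for f f'
    using that
  proof (induction "degree f" arbitrary: f f' rule: less_induct)
    case less
    show ?case
    proof (rule ccontr)
      assume f: "poly f \<alpha> \<noteq> 0"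
      then have f0: "f \<noteq> 0" by auto
      have degf: "degree f > 0"
      proof (rule ccontr)
        assume "\<not> ?thesis"
        then have "degree f = 0" "degree f' = 0" using polys_degree less.prems by auto
        then obtain a' where "f' = [:a':]" using degree_eq_zeroE by blast
        then show False using less.prems polys_eq_0_iff f0 by auto
      qed
      obtain c c' r r' where d: "(c, c') \<in> polys" "(r, r') \<in> polys"
        "g = f * c + r" "g' = f' * c' + r'" "r = 0 \<or> degree r < degree f"
        using polys_division[OF less.prems(1) f0 g(1)] by blast
      have "poly r' \<beta> = 0" using d(4) \<beta> less.prems by simp
      then have r: "poly r \<alpha> = 0" using d(2,5) less.hyps by auto
      then have "poly c \<alpha> = 0" using d(3) g(3) f by simp
      show False
      proof (cases "c = 0")
        \<comment> \<open>Now \<open>g\<close> has smaller degree than \<open>f\<close>. Reducing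
          \<open>f\<close> modulo \<open>g\<close> changes neither value and lowers the degree, so
          the induction hypothesis applies to the remainder.\<close>
        case True
        then have "g = r" using d by simp
        then have gf: "degree g < degree f" using d(5) g(2) by auto
        obtain c c' r r' where d: "(c, c') \<in> polys" "(r, r') \<in> polys"
          "f = g * c + r" "f' = g' * c' + r'" "r = 0 \<or> degree r < degree g"
          using polys_division[OF g(1,2) less.prems(1)] by blast
        have "poly r' \<beta> = 0" "poly r \<alpha> = poly f \<alpha>" using d g \<beta> less.prems by auto
        then show False using less.hyps[of r r'] d(2,5) f gf by auto
      next
        case False
        have "degree (f * c) = degree g"
        proof (cases "r = 0")
          case False
          then have "degree r < degree (f * c)" using d(5) \<open>c \<noteq> 0\<close> f0 by (simp add: degree_mult_eq)
          then show ?thesis using d(3) by (simp add: degree_add_eq_left)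
        qed (use d in auto)
        then have "degree c < degree g" using degf False f0 by (simp add: degree_mult_eq)
        then show False using min[OF d(1) \<open>poly c \<alpha> = 0\<close>] False by simp
      qed
    qed
  qed
  \<comment> \<open>Only the ring structure of the evaluations is checked; passing to fractions then
    supplies inverses without Bezout identities.\<close>
  define R where "R = {(poly f \<alpha>, poly f' \<beta>) | f f'. (f, f') \<in> polys}"
  have "ring_graph R"
  proof
    have "(poly [:1:] \<alpha>, poly [:1:] \<beta>) \<in> R" unfolding R_def using polys_const[OF one] by blast
    then show "(1, 1) \<in> R" by simp
    fix x y assume "(x, y) \<in> R"
    then obtain f f' where f: "(f, f') \<in> polys" "x = poly f \<alpha>" "y = poly f' \<beta>" by (auto simp: R_def)
    then show "x = 0 \<longleftrightarrow> y = 0" using zero1[OF f(1)] nz[OF f(1)] by auto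
    fix x' y' assume "(x', y') \<in> R"
    then obtain k k' where k: "(k, k') \<in> polys" "x' = poly k \<alpha>" "y' = poly k' \<beta>" by (auto simp: R_def)
    have "x - x' = poly (f - k) \<alpha>" "y - y' = poly (f' - k') \<beta>" "x * x' = poly (f * k) \<alpha>" "y * y' = poly (f' * k') \<beta>"
      using f k by auto
    then show "(x - x', y - y') \<in> R" "(x * x', y * y') \<in> R"
      unfolding R_def using polys_diff[OF f(1) k(1)] polys_mult[OF f(1) k(1)] by blast+
  qed
  then interpret R: ring_graph R .
  let ?T = "{(x / x', y / y') | x y x' y'. (x, y) \<in> R \<and> (x', y') \<in> R \<and> x' \<noteq> 0}"
  have RT: "(x, y) \<in> ?T" if "(x, y) \<in> R" for x y
  proof -
    have "(x / 1, y / 1) \<in> ?T" using that R.one one_neq_zero by blast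
    then show ?thesis by simp
  qed
  have "(x, y) \<in> ?T" if "(x, y) \<in> S" for x y
  proof -
    have "(poly [:x:] \<alpha>, poly [:y:] \<beta>) \<in> R" unfolding R_def using polys_const[OF that] by blast
    then show ?thesis using RT by simp
  qed
  then have "S \<subseteq> ?T" by (simp add: subset_iff)
  moreover have "(poly [:0, 1:] \<alpha>, poly [:0, 1:] \<beta>) \<in> R" unfolding R_def using polys_pCons_X by blast
  then have "\<alpha> \<in> fst ` ?T" using RT[of \<alpha> \<beta>] by (intro image_eqI[of _ _ "(\<alpha>, \<beta>)"]) simp_all
  ultimately have "S \<subseteq> ?T" "\<alpha> \<in> fst ` ?T" by blast+
  then show ?thesis using R.fractions by blast
qed

text \<open>The hypothesis on \<open>A'\<close> counts roots in the whole target field and is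
  unaffected when the graph grows, so the roots of \<open>A\<close> can be adjoined one at a
  time.\<close>

lemma adjoin_roots:
  assumes A: "(A, A') \<in> polys" "A \<noteq> 0" "card {z. poly A' z = 0} = degree A'"
  shows "\<exists>T. field_graph T \<and> S \<subseteq> T \<and> {z. poly A z = 0} \<subseteq> fst ` T"
proof -
  have "\<exists>T. field_graph T \<and> S \<subseteq> T \<and> Z \<subseteq> fst ` T" if "finite Z" "Z \<subseteq> {z. poly A z = 0}" for Z
    using that
  proof (induction Z rule: finite_induct)
    case empty
    show ?case using field_graph_axioms by blast
  next
    case (insert \<alpha> Z)
    then obtain T where T: "field_graph T" "S \<subseteq> T" "Z \<subseteq> fst ` T" by auto
    interpret T: field_graph T by fact
    have "(A, A') \<in> T.polys" using A(1) T(2) by (auto simp: polys_def T.polys_def)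
    then obtain U where "field_graph U" "T \<subseteq> U" "\<alpha> \<in> fst ` U"
      using T.adjoin_root[OF _ A(2,3), of \<alpha>] insert.prems by auto
    moreover from this have "S \<subseteq> U" "insert \<alpha> Z \<subseteq> fst ` U" using T by blast+
    ultimately show ?case by blast
  qed
  then show ?thesis using poly_roots_finite[OF A(2)] by blast
qed

end

section \<open>Additive polynomials in characteristic two\<close>

lemma power_add_char_two:
  fixes x y :: "'b::comm_ring_1"
  assumes "(2::'b) = 0"
  shows "(x + y) ^ (2 ^ k) = x ^ (2 ^ k) + y ^ (2 ^ k)"
proof (induction k)
  case (Suc k)
  have "(x + y) ^ (2 ^ Suc k) = ((x + y) ^ (2 ^ k))\<^sup>2"
    by (simp add: power_mult[symmetric] mult.commute)
  also have "\<dots> = (x ^ 2 ^ k)\<^sup>2 + (y ^ 2 ^ k)\<^sup>2"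
    using assms by (simp add: Suc power2_sum)
  finally show ?case by (simp add: power_mult[symmetric] mult.commute)
qed simp

lemma power_sum_char_two:
  fixes f :: "'i \<Rightarrow> 'b::comm_ring_1"
  assumes "(2::'b) = 0"
  shows "(\<Sum>i\<in>A. f i) ^ (2 ^ k) = (\<Sum>i\<in>A. f i ^ (2 ^ k))"
  by (induction A rule: infinite_finite_induct) (simp_all add: power_add_char_two[OF assms] power_0_left)

lemma uminus_char_two:
  fixes x :: "'b::comm_ring_1"
  assumes "(2::'b) = 0"
  shows "- x = x"
proof -
  have "x + x = 2 * x" by (simp only: mult_2)
  then show ?thesis using assms by (simp add: eq_neg_iff_add_eq_0 minus_equation_iff)
qed

text \<open>Stated over any commutative ring because the same shape occurs with coefficients in
  F_q[t], F_q(t), \<open>K\<close> and the Laurent series over \<open>K\<close>.\<close>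

definition additive_poly :: "nat \<Rightarrow> nat \<Rightarrow> (nat \<Rightarrow> 'b::comm_ring_1) \<Rightarrow> 'b poly" where
  "additive_poly q r a = (\<Sum>i\<le>r. monom (a i) (q ^ i))"

lemma poly_additive_poly: "poly (additive_poly q r a) x = (\<Sum>i\<le>r. a i * x ^ (q ^ i))"
  by (simp add: additive_poly_def poly_sum poly_monom)

lemma coeff_additive_poly: "coeff (additive_poly q r a) n = (\<Sum>i\<le>r. if q ^ i = n then a i else 0)"
  by (simp add: additive_poly_def coeff_sum)

lemma coeff_additive_poly_top:
  assumes "q \<ge> 2"
  shows "coeff (additive_poly q r a) (q ^ r) = a r"
proof -
  have "(q ^ i = q ^ r) = (i = r)" for i
    using assms by (simp add: power_inject_exp)
  then show ?thesis by (simp add: coeff_additive_poly)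
qed

lemma degree_additive_poly:
  assumes "q \<ge> 2" "a r \<noteq> 0"
  shows "degree (additive_poly q r a) = q ^ r"
proof (rule antisym)
  show "degree (additive_poly q r a) \<le> q ^ r"
  proof (rule degree_le, intro allI impI)
    fix n assume "q ^ r < n"
    then have "q ^ i \<noteq> n" if "i \<le> r" for i
      using that power_increasing[of i r q] assms by auto
    then show "coeff (additive_poly q r a) n = 0"
      by (simp add: coeff_additive_poly)
  qed
  show "q ^ r \<le> degree (additive_poly q r a)"
    using assms by (intro le_degree) (simp add: coeff_additive_poly_top)
qed

text \<open>The exponents \<open>q ^ i\<close> with \<open>i > 0\<close> are even. A nonzero
  \<open>a 0\<close> therefore makes all roots simple.\<close>

lemma pderiv_additive_poly:
  fixes a :: "nat \<Rightarrow> 'b::field"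
  assumes "(2::'b) = 0" "q = 2 ^ k" "k > 0"
  shows "pderiv (additive_poly q r a) = [:a 0:]"
proof -
  have "of_nat (q ^ i) = (0::'b)" if "i > 0" for i
    using assms that by (simp add: power_0_left)
  then have "pderiv (additive_poly q r a) = (\<Sum>i\<le>r. if i = 0 then [:a 0:] else 0)"
    unfolding additive_poly_def pderiv_sum
    by (intro sum.cong) (auto simp: pderiv_monom monom_0)
  then show ?thesis by simp
qed

lemma card_roots_alg_closed:
  fixes p :: "'b::field poly"
  assumes "alg_closed_type TYPE('b)" "p \<noteq> 0" "\<And>z. poly p z = 0 \<Longrightarrow> poly (pderiv p) z \<noteq> 0"
  shows "card {z. poly p z = 0} = degree p"
  using assms(2,3)
proof (induction "degree p" arbitrary: p)
  case 0
  then obtain c where "p = [:c:]" using degree_eq_zeroE by metis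
  then show ?case using 0 by simp
next
  case (Suc n)
  then obtain z where z: "poly p z = 0" using assms(1) unfolding alg_closed_type_def by (metis zero_less_Suc)
  then obtain r where p: "p = [:- z, 1:] * r" using poly_eq_0_iff_dvd[of p z] by (auto elim: dvdE)
  have d: "pderiv p = r + [:- z, 1:] * pderiv r"
    unfolding p pderiv_mult by (simp add: pderiv_pCons)
  have r0: "r \<noteq> 0" using Suc.prems p by auto
  have deg: "degree p = Suc (degree r)" unfolding p using r0 by (subst degree_mult_eq) auto
  have rz: "poly r z \<noteq> 0" using Suc.prems(2)[OF z] d by simp
  have "card {z. poly r z = 0} = degree r"
  proof (rule Suc.hyps(1))
    show "n = degree r" "r \<noteq> 0" using Suc.hyps(2) deg r0 by auto
    fix w assume "poly r w = 0"
    then show "poly (pderiv r) w \<noteq> 0" using Suc.prems(2)[of w] d by (auto simp: p)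
  qed
  moreover have "{w. poly p w = 0} = insert z {w. poly r w = 0}" by (auto simp: p)
  ultimately show ?case using rz deg poly_roots_finite[OF r0] by simp
qed

lemma card_roots_additive_poly:
  fixes a :: "nat \<Rightarrow> 'b::field"
  assumes "alg_closed_type TYPE('b)" "(2::'b) = 0" "q = 2 ^ k" "k > 0" "a 0 \<noteq> 0" "a r \<noteq> 0"
  shows "card {z. poly (additive_poly q r a) z = 0} = q ^ r"
proof -
  have "2 ^ 1 \<le> q" unfolding assms(3) using assms(4) by (intro power_increasing) auto
  then have deg: "degree (additive_poly q r a) = q ^ r"
    by (intro degree_additive_poly assms) simp
  have "additive_poly q r a \<noteq> 0"
  proof
    assume "additive_poly q r a = 0"
    then show False using pderiv_additive_poly[OF assms(2-4), of r a] assms(5) by simp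
  qed
  then show ?thesis
    using card_roots_alg_closed[OF assms(1)] pderiv_additive_poly[OF assms(2-4), of r a] assms(5) deg by auto
qed

section \<open>Power series\<close>

lemma fps_two_eq_zero: "(2::'k::field) = 0 \<Longrightarrow> (2::'k fps) = 0"
  by (simp add: numeral_fps_const)

text \<open>Cut \<open>Y\<close> after the term of index \<open>n\<close>. The power map is
  additive, and the tail contributes only from index \<open>Suc n * 2 ^ k\<close> on, so the finite
  part decides the coefficient.\<close>

lemma fps_nth_power_char_two:
  fixes Y :: "'k::field fps"
  assumes "(2::'k) = 0"
  shows "fps_nth (Y ^ (2 ^ k)) n = (if 2 ^ k dvd n then fps_nth Y (n div 2 ^ k) ^ (2 ^ k) else 0)"
proof -
  define Q where "Q = (2::nat) ^ k"
  have Q: "Q > 0" by (simp add: Q_def)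
  have cut: "fps_cutoff (Suc n) Y = (\<Sum>j\<le>n. fps_const (fps_nth Y j) * fps_X ^ j)"
    by (rule fps_ext) (simp add: fps_sum_nth fps_X_power_nth if_distrib[of "\<lambda>x. _ * x"] less_Suc_eq_le cong: if_cong)
  have "Y = fps_shift (Suc n) Y * fps_X ^ Suc n + fps_cutoff (Suc n) Y"
    by (rule fps_shift_cutoff[symmetric])
  then have "Y ^ Q = (fps_shift (Suc n) Y * fps_X ^ Suc n) ^ Q + fps_cutoff (Suc n) Y ^ Q"
    unfolding Q_def using power_add_char_two[OF fps_two_eq_zero[OF assms]] by metis
  also have "fps_cutoff (Suc n) Y ^ Q = (\<Sum>j\<le>n. fps_const (fps_nth Y j ^ Q) * fps_X ^ (j * Q))"
    unfolding cut Q_def power_sum_char_two[OF fps_two_eq_zero[OF assms]]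
    by (simp add: power_mult_distrib fps_const_power power_mult)
  also have "(fps_shift (Suc n) Y * fps_X ^ Suc n) ^ Q = fps_shift (Suc n) Y ^ Q * fps_X ^ (Suc n * Q)"
    by (simp only: power_mult_distrib power_mult)
  finally have "fps_nth (Y ^ Q) n = fps_nth (fps_shift (Suc n) Y ^ Q * fps_X ^ (Suc n * Q)) n
      + (\<Sum>j\<le>n. if n = j * Q then fps_nth Y j ^ Q else 0)"
    by (simp add: fps_sum_nth fps_X_power_nth if_distrib[of "\<lambda>x. _ * x"] cong: if_cong)
  also have "fps_nth (fps_shift (Suc n) Y ^ Q * fps_X ^ (Suc n * Q)) n = 0"
  proof -
    have "n < Suc n * Q" using Q by (metis lessI less_le_trans mult.right_neutral mult_le_mono2 Suc_leI One_nat_def)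
    then show ?thesis by (simp only: fps_X_power_mult_right_nth if_True)
  qed
  also have "(\<Sum>j\<le>n. if n = j * Q then fps_nth Y j ^ Q else 0) = (if Q dvd n then fps_nth Y (n div Q) ^ Q else 0)"
  proof (cases "Q dvd n")
    case True
    then have "(n = j * Q) = (j = n div Q)" for j using Q by auto
    then show ?thesis using True by simp
  next
    case False
    then have "n \<noteq> j * Q" for j by auto
    then show ?thesis using False by simp
  qed
  finally show ?thesis unfolding Q_def by simp
qed

text \<open>Serves to define the coefficients of a power series one after another; the mask
  \<open>undefined\<close> enforces that only earlier values are used.\<close>

lemma nat_course_of_values_recursion: "\<exists>f::nat \<Rightarrow> 'b. \<forall>n. f n = G (\<lambda>j. if j < n then f j else undefined) n"
proof -
  let ?f = "wfrec less_than G"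
  have "?f n = G (\<lambda>j. if j < n then ?f j else undefined) n" for n
    by (subst wfrec[OF wf_less_than]) (simp add: cut_def)
  then show ?thesis by blast
qed

text \<open>Hensel lifting: since \<open>a 0 = 1\<close>, the \<open>n\<close>-th coefficient of the equation expresses the
  \<open>n\<close>-th coefficient of the solution through coefficients with smaller index.\<close>

lemma hensel_additive:
  fixes a :: "nat \<Rightarrow> 'k::field fps"
  assumes char: "(2::'k) = 0" and q: "q = 2 ^ k" "k > 0" and a0: "a 0 = 1"
    and w: "(\<Sum>i\<le>r. fps_nth (a i) 0 * w ^ (q ^ i)) = 0"
  shows "\<exists>Y. fps_nth Y 0 = w \<and> (\<Sum>i\<le>r. a i * Y ^ (q ^ i)) = 0"
proof -
  \<comment> \<open>The \<open>i = 0\<close> summand is \<open>Y\<close> itself and is solved for.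
    For \<open>i \<ge> 1\<close> the coefficients of \<open>Y ^ (q ^ i)\<close> up to index
    \<open>n\<close> involve \<open>y\<close> only at indices at most \<open>n div q ^ i\<close>,
    which is below \<open>n\<close> for \<open>n > 0\<close>.\<close>
  define G where "G = (\<lambda>(y::nat \<Rightarrow> 'k) n. if n = 0 then w else
    - (\<Sum>i=1..r. \<Sum>j=0..n. fps_nth (a i) j * (if q ^ i dvd n - j then y ((n - j) div q ^ i) ^ (q ^ i) else 0)))"
  obtain y where y: "\<And>n. y n = G (\<lambda>j. if j < n then y j else undefined) n"
    using nat_course_of_values_recursion[of G] by blast
  define Y where "Y = Abs_fps y"
  have qi: "q ^ i = 2 ^ (k * i)" for i by (simp add: q power_mult)
  have pow: "fps_nth (Y ^ (q ^ i)) n = (if q ^ i dvd n then y (n div q ^ i) ^ (q ^ i) else 0)" for i n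
    unfolding qi fps_nth_power_char_two[OF char] by (simp add: Y_def)
  have y0: "y 0 = w" by (subst y) (simp add: G_def)
  have "fps_nth (\<Sum>i\<le>r. a i * Y ^ (q ^ i)) n = 0" for n
  proof (cases "n = 0")
    case True
    then show ?thesis using w by (simp add: fps_sum_nth fps_mult_nth pow y0)
  next
    case False
    have less: "(n - j) div q ^ i < n" if "i \<in> {1..r}" for i j
    proof -
      have "1 < q ^ i" unfolding qi using q that by (intro one_less_power) auto
      then have "(n - j) div q ^ i < n - j \<or> n - j = 0" by (metis div_less_dividend gr0I)
      then show ?thesis using False by auto
    qed
    have "y n = - (\<Sum>i=1..r. \<Sum>j=0..n. fps_nth (a i) j * fps_nth (Y ^ (q ^ i)) (n - j))"
      unfolding pow by (subst y)
        (simp only: G_def False if_False, intro arg_cong[of _ _ uminus] sum.cong refl, simp add: less)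
    moreover have "{..r} = insert 0 {1..r}" by auto
    ultimately show ?thesis
      by (simp add: fps_sum_nth fps_mult_nth a0 Y_def)
  qed
  then have "(\<Sum>i\<le>r. a i * Y ^ (q ^ i)) = 0" by (intro fps_ext) simp
  then show ?thesis using y0 by (intro exI[of _ Y]) (simp add: Y_def)
qed

text \<open>If \<open>z\<close> had negative order \<open>d\<close>, the leading power
  \<open>z ^ n\<close> would have order \<open>n * d\<close>, strictly below that of every other
  summand, and could not cancel.\<close>

lemma fls_integral_over_fps:
  fixes z :: "'k::field fls"
  assumes p: "lead_coeff p = 1" "poly p z = 0" and c: "\<And>i. fls_subdegree (coeff p i) \<ge> 0"
  shows "fls_subdegree z \<ge> 0"
proof (rule ccontr)
  assume neg: "\<not> ?thesis"
  then have z: "z \<noteq> 0" by auto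
  define n where "n = degree p"
  define d where "d = fls_subdegree z"
  have "fls_nth (coeff p i * z ^ i) (int n * d) = 0" if "i < n" for i
  proof (cases "coeff p i = 0")
    case False
    then have "fls_subdegree (coeff p i * z ^ i) \<ge> int i * d"
      using z c[of i] by (simp add: fls_subdegree_pow d_def)
    moreover have "int n * d < int i * d" using neg that by (simp add: d_def mult_less_cancel_right)
    ultimately show ?thesis by (intro fls_eq0_below_subdegree) simp
  qed simp
  then have "fls_nth (\<Sum>i<n. coeff p i * z ^ i) (int n * d) = 0" by (simp add: fls_nth_sum)
  moreover have "poly p z = (\<Sum>i<n. coeff p i * z ^ i) + z ^ n"
    using p(1) by (simp add: poly_altdef n_def lessThan_Suc_atMost[symmetric])
  moreover have "fls_nth (z ^ n) (int n * d) \<noteq> 0"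
    using nth_fls_subdegree_nonzero[of "z ^ n"] z by (simp add: fls_subdegree_pow d_def)
  ultimately show False using p(2) by (metis add_0 fls_plus_nth fls_zero_nth)
qed

text \<open>Not the \<open>Q\<close>-th power of the series: the variable stays fixed, so for
  \<open>Q = q\<close> all series with coefficients in F_q are fixed.\<close>

definition fls_frobenius :: "nat \<Rightarrow> 'k::field fls \<Rightarrow> 'k fls" where
  "fls_frobenius Q f = Abs_fls (\<lambda>n. fls_nth f n ^ Q)"

lemma fls_frobenius_nth: "Q > 0 \<Longrightarrow> fls_nth (fls_frobenius Q f) n = fls_nth f n ^ Q"
  unfolding fls_frobenius_def
  by (rule nth_Abs_fls_lower_bound[of "fls_subdegree f"]) simp

text \<open>Needed for multiplicativity: the finite sums giving the coefficients of a product have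
  bounds depending on the subdegrees.\<close>

lemma fls_frobenius_subdegree: "Q > 0 \<Longrightarrow> fls_subdegree (fls_frobenius Q f) = fls_subdegree f"
proof (cases "f = 0")
  case True
  assume "Q > 0"
  then have "fls_frobenius Q f = 0" using True by (intro fls_eqI) (simp add: fls_frobenius_nth)
  then show ?thesis using True by simp
qed (intro fls_subdegree_eqI; simp add: fls_frobenius_nth)

lemma fls_frobenius_inject:
  assumes "inj (\<lambda>x::'k::field. x ^ Q)" "Q > 0" "fls_frobenius Q f = fls_frobenius Q (g :: 'k fls)"
  shows "f = g"
proof (rule fls_eqI)
  fix n
  have "fls_nth f n ^ Q = fls_nth g n ^ Q" using assms(2,3) by (metis fls_frobenius_nth)
  then show "fls_nth f n = fls_nth g n" using assms(1) by (auto dest: injD)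
qed

context
  fixes k Q assumes char: "(2::'k::field) = 0" and Q: "Q = (2::nat) ^ k"
begin

lemma fls_frobenius_add: "fls_frobenius Q (f + g :: 'k fls) = fls_frobenius Q f + fls_frobenius Q g"
  using Q by (intro fls_eqI) (simp add: fls_frobenius_nth power_add_char_two[OF char])

lemma fls_frobenius_mult: "fls_frobenius Q (f * g :: 'k fls) = fls_frobenius Q f * fls_frobenius Q g"
  using Q by (intro fls_eqI)
    (simp add: fls_frobenius_nth fls_times_nth(2) power_sum_char_two[OF char] power_mult_distrib fls_frobenius_subdegree)

lemma inj_power_char_two: "inj (\<lambda>x::'k. x ^ Q)"
proof (rule injI)
  fix x y :: 'k assume "x ^ Q = y ^ Q"
  then have "(x + y) ^ Q = x ^ Q + x ^ Q" unfolding Q power_add_char_two[OF char] by simp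
  also have "\<dots> = 2 * x ^ Q" by (simp only: mult_2)
  finally have "x + y = 0" by (simp add: char)
  then have "x = - y" by (simp add: eq_neg_iff_add_eq_0)
  then show "x = y" by (simp add: uminus_char_two[OF char])
qed

end

section \<open>Integral elements form a ring\<close>

definition integral_over :: "('a::comm_ring_1 \<Rightarrow> 'k::field) \<Rightarrow> 'k \<Rightarrow> bool" where
  "integral_over h z \<longleftrightarrow> (\<exists>p. lead_coeff p = 1 \<and> poly (map_poly h p) z = 0)"

definition span_over :: "('a::comm_ring_1 \<Rightarrow> 'k::field) \<Rightarrow> 'k set \<Rightarrow> 'k set" where
  "span_over h B = {\<Sum>b\<in>B. h (c b) * b | c. True}"

context
  fixes h :: "'a::comm_ring_1 \<Rightarrow> 'k::field"
  assumes hom: "comm_ring_hom h"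
begin

interpretation h: comm_ring_hom h by (rule hom)

lemma integral_over_hom: "integral_over h (h c)"
  unfolding integral_over_def
  by (rule exI[of _ "[:- c, 1:]"]) (simp add: hom_distribs)

text \<open>The element \<open>z\<close> is an eigenvalue of the matrix of multiplication by \<open>z\<close>, hence a root of
  its characteristic polynomial.\<close>

lemma integral_over_if_span_stable:
  assumes "finite B" "b\<^sub>0 \<in> B" "b\<^sub>0 \<noteq> 0" "\<And>b. b \<in> B \<Longrightarrow> z * b \<in> span_over h B"
  shows "integral_over h z"
proof -
  define n where "n = card B"
  obtain f where f: "bij_betw f {..<n} B"
    using ex_bij_betw_nat_finite[OF assms(1)] by (auto simp: n_def atLeast0LessThan)
  have "\<exists>c. z * b = (\<Sum>b'\<in>B. h (c b') * b')" if "b \<in> B" for b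
    using assms(4)[OF that] by (auto simp: span_over_def)
  then obtain c where c: "\<And>b. b \<in> B \<Longrightarrow> z * b = (\<Sum>b'\<in>B. h (c b b') * b')" by metis
  \<comment> \<open>The entries lie in the base ring, so the characteristic polynomial is already
    monic over that ring before \<open>h\<close> is applied.\<close>
  define A where "A = mat n n (\<lambda>(i, j). c (f i) (f j))"
  define v where "v = vec n f"
  have A: "A \<in> carrier_mat n n" by (simp add: A_def)
  have "map_mat h A *\<^sub>v v = z \<cdot>\<^sub>v v"
  proof (rule eq_vecI)
    fix i assume "i < dim_vec (z \<cdot>\<^sub>v v)"
    then have i: "i < n" by (simp add: v_def)
    then have "f i \<in> B" using f by (auto simp: bij_betw_def)
    then have "z * f i = (\<Sum>b'\<in>B. h (c (f i) b') * b')" by (rule c)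
    also have "\<dots> = (\<Sum>j<n. h (c (f i) (f j)) * f j)"
      by (rule sum.reindex_bij_betw[OF f, symmetric])
    finally show "vec_index (map_mat h A *\<^sub>v v) i = vec_index (z \<cdot>\<^sub>v v) i"
      using i by (simp add: A_def v_def scalar_prod_def atLeast0LessThan)
  qed (simp add: A_def v_def)
  moreover have "v \<noteq> 0\<^sub>v n"
  proof
    assume v: "v = 0\<^sub>v n"
    obtain i where "i < n" "f i = b\<^sub>0" using f assms(2) by (auto simp: bij_betw_def)
    then have "vec_index v i \<noteq> 0" using assms(3) by (simp add: v_def)
    then show False using v \<open>i < n\<close> by simp
  qed
  ultimately have "eigenvalue (map_mat h A) z"
    unfolding eigenvalue_def eigenvector_def using A by (intro exI[of _ v]) (simp add: v_def)
  then have "poly (char_poly (map_mat h A)) z = 0"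
    using eigenvalue_root_char_poly[of "map_mat h A" n] A by simp
  then have "poly (map_poly h (char_poly A)) z = 0" using h.char_poly_hom[OF A] by simp
  then show ?thesis
    unfolding integral_over_def using degree_monic_char_poly[OF A] by (intro exI[of _ "char_poly A"]) simp
qed

lemma span_over_add: "x \<in> span_over h B \<Longrightarrow> y \<in> span_over h B \<Longrightarrow> x + y \<in> span_over h B"
proof -
  assume "x \<in> span_over h B" "y \<in> span_over h B"
  then obtain c d where "x = (\<Sum>b\<in>B. h (c b) * b)" "y = (\<Sum>b\<in>B. h (d b) * b)"
    by (auto simp: span_over_def)
  then have "x + y = (\<Sum>b\<in>B. h (c b + d b) * b)"
    by (simp add: hom_distribs distrib_right sum.distrib)
  then show ?thesis by (auto simp: span_over_def)
qed

lemma span_over_scale: "x \<in> span_over h B \<Longrightarrow> h a * x \<in> span_over h B"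
proof -
  assume "x \<in> span_over h B"
  then obtain c where "x = (\<Sum>b\<in>B. h (c b) * b)" by (auto simp: span_over_def)
  then have "h a * x = (\<Sum>b\<in>B. h (a * c b) * b)"
    by (simp add: hom_distribs sum_distrib_left mult.assoc)
  then show ?thesis by (auto simp: span_over_def)
qed

lemma span_over_uminus: "x \<in> span_over h B \<Longrightarrow> - x \<in> span_over h B"
  using span_over_scale[of x B "- 1"] by (simp add: hom_distribs)

lemma span_over_base:
  assumes "finite B" "b \<in> B"
  shows "b \<in> span_over h B"
proof -
  have "(\<Sum>b'\<in>B. h (if b' = b then 1 else 0) * b') = (\<Sum>b'\<in>B. if b' = b then b' else 0)"
    by (intro sum.cong) auto
  then have "b = (\<Sum>b'\<in>B. h (if b' = b then 1 else 0) * b')" using assms by simp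
  then show ?thesis unfolding span_over_def by (intro CollectI exI[of _ "\<lambda>b'. if b' = b then 1 else 0"]) simp
qed

lemma span_over_zero: "0 \<in> span_over h B"
  unfolding span_over_def by (auto intro!: exI[of _ "\<lambda>_. 0"])

lemma span_over_sum: "(\<And>i. i \<in> I \<Longrightarrow> f i \<in> span_over h B) \<Longrightarrow> (\<Sum>i\<in>I. f i) \<in> span_over h B"
  by (induction I rule: infinite_finite_induct) (auto intro: span_over_zero span_over_add)

lemma span_over_stable:
  assumes "\<And>b. b \<in> B \<Longrightarrow> z * b \<in> span_over h B" "x \<in> span_over h B"
  shows "z * x \<in> span_over h B"
proof -
  obtain c where "x = (\<Sum>b\<in>B. h (c b) * b)" using assms(2) by (auto simp: span_over_def)
  then have "z * x = (\<Sum>b\<in>B. h (c b) * (z * b))" by (simp add: sum_distrib_left mult_ac)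
  also have "\<dots> \<in> span_over h B" by (intro span_over_sum span_over_scale assms(1))
  finally show ?thesis .
qed

lemma integral_over_power_eq:
  assumes "integral_over h x"
  shows "\<exists>n c. n > 0 \<and> x ^ n = (\<Sum>i<n. h (c i) * x ^ i)"
proof -
  obtain p where p: "lead_coeff p = 1" "poly (map_poly h p) x = 0"
    using assms by (auto simp: integral_over_def)
  have eq: "poly (map_poly h p) x = (\<Sum>i<degree p. h (coeff p i) * x ^ i) + x ^ degree p"
  proof -
    have "degree (map_poly h p) = degree p" using p(1) by (intro degree_map_poly) auto
    then show ?thesis using p(1) by (simp add: poly_altdef coeff_map_poly lessThan_Suc_atMost[symmetric])
  qed
  then have "x ^ degree p = (\<Sum>i<degree p. h (- coeff p i) * x ^ i)"
    using p(2) by (simp add: hom_distribs sum_negf eq_neg_iff_add_eq_0 add.commute)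
  moreover have "degree p > 0" using eq p by (intro gr0I) simp
  ultimately show ?thesis by (intro exI[of _ "degree p"] exI[of _ "\<lambda>i. - coeff p i"]) simp
qed

text \<open>The products \<open>x ^ i * y ^ j\<close> with \<open>i < n\<close> and
  \<open>j < m\<close> span a module stable under multiplication by \<open>x\<close> and by
  \<open>y\<close>, the monic relations reducing \<open>x ^ n\<close> and \<open>y ^ m\<close>.
  Hence it is stable under \<open>x + y\<close>, \<open>x * y\<close> and
  \<open>- x\<close>.\<close>

lemma integral_over_ring:
  assumes "integral_over h x" "integral_over h y"
  shows "integral_over h (x + y)" "integral_over h (x * y)" "integral_over h (- x)"
proof -
  obtain n c where n: "n > 0" "x ^ n = (\<Sum>i<n. h (c i) * x ^ i)" using integral_over_power_eq[OF assms(1)] by blast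
  obtain m d where m: "m > 0" "y ^ m = (\<Sum>i<m. h (d i) * y ^ i)" using integral_over_power_eq[OF assms(2)] by blast
  define B where "B = (\<lambda>(i, j). x ^ i * y ^ j) ` ({..<n} \<times> {..<m})"
  have fin: "finite B" by (simp add: B_def)
  have B: "x ^ i * y ^ j \<in> span_over h B" if "i < n" "j < m" for i j
    using that by (intro span_over_base fin) (auto simp: B_def)
  have xB: "x * b \<in> span_over h B" if "b \<in> B" for b
  proof -
    obtain i j where ij: "i < n" "j < m" "b = x ^ i * y ^ j" using \<open>b \<in> B\<close> by (auto simp: B_def)
    show ?thesis
    proof (cases "Suc i < n")
      case True
      then show ?thesis using B[of "Suc i" j] ij by (simp add: mult_ac)
    next
      case False
      then have "Suc i = n" using ij by simp
      then have "x * b = x ^ n * y ^ j" using ij by (auto simp: mult_ac)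
      also have "\<dots> = (\<Sum>i<n. h (c i) * (x ^ i * y ^ j))" unfolding n(2) by (simp add: sum_distrib_right mult.assoc)
      also have "\<dots> \<in> span_over h B" using ij by (intro span_over_sum span_over_scale B) auto
      finally show ?thesis .
    qed
  qed
  have yB: "y * b \<in> span_over h B" if "b \<in> B" for b
  proof -
    obtain i j where ij: "i < n" "j < m" "b = x ^ i * y ^ j" using \<open>b \<in> B\<close> by (auto simp: B_def)
    show ?thesis
    proof (cases "Suc j < m")
      case True
      then show ?thesis using B[of i "Suc j"] ij by (simp add: mult_ac)
    next
      case False
      then have "Suc j = m" using ij by simp
      then have "y * b = x ^ i * y ^ m" using ij by (auto simp: mult_ac)
      also have "\<dots> = (\<Sum>j<m. h (d j) * (x ^ i * y ^ j))" unfolding m(2) by (simp add: sum_distrib_left mult_ac)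
      also have "\<dots> \<in> span_over h B" using ij by (intro span_over_sum span_over_scale B) auto
      finally show ?thesis .
    qed
  qed
  have "1 \<in> B" using n m by (auto simp: B_def intro!: image_eqI[of _ _ "(0, 0)"])
  note I = integral_over_if_span_stable[OF fin \<open>1 \<in> B\<close> one_neq_zero]
  show "integral_over h (x + y)" using xB yB by (intro I) (auto simp: distrib_right intro: span_over_add)
  show "integral_over h (- x)" using xB by (intro I) (auto intro: span_over_uminus)
  show "integral_over h (x * y)"
  proof (rule I)
    fix b assume "b \<in> B"
    then have "x * (y * b) \<in> span_over h B" using span_over_stable[OF xB yB] by simp
    then show "x * y * b \<in> span_over h B" by (simp add: mult.assoc)
  qed
qed

end

section \<open>The polynomial f\<close>

text \<open>Pairs the index \<open>m - j\<close> with \<open>m + j\<close>, as the symmetry of a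
  self-reciprocal polynomial requires.\<close>

lemma sum_symmetric_split:
  fixes g :: "nat \<Rightarrow> 'b::comm_monoid_add"
  shows "(\<Sum>i\<le>2 * m. g i) = g m + (\<Sum>j=1..m. g (m - j) + g (m + j))"
proof -
  have "{..2 * m} = {..<m} \<union> ({m} \<union> {m + 1..m + m})" by auto
  then have "(\<Sum>i\<le>2 * m. g i) = (\<Sum>i<m. g i) + (g m + (\<Sum>i=m+1..m+m. g i))"
    by (simp only:) (subst sum.union_disjoint; force)+
  moreover have "(\<Sum>i<m. g i) = (\<Sum>j=1..m. g (m - j))"
    by (rule sum.reindex_bij_witness[of _ "\<lambda>j. m - j" "\<lambda>i. m - i"]) auto
  moreover have "(\<Sum>i=m+1..m+m. g i) = (\<Sum>j=1..m. g (m + j))"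
    by (rule sum.reindex_bij_witness[of _ "\<lambda>j. m + j" "\<lambda>i. i - m"]) auto
  ultimately show ?thesis by (simp add: sum.distrib add_ac)
qed

text \<open>Existence is explicit: the \<open>q\<close>-th power sends \<open>T j l\<close> to
  \<open>T j (Suc l)\<close>, so \<open>f ^ q - f\<close> telescopes to the terms
  \<open>T j j - T j 0\<close>, which are the paired terms of the right-hand side. Two solutions
  differ by some \<open>d\<close> with \<open>d ^ q = d\<close>, a constant by degree, and it is
  \<open>0\<close> by the condition at \<open>0\<close>.\<close>

lemma fpoly_spec:
  fixes M :: "'a::field poly"
  assumes char: "(2::'a) = 0" and q: "q = 2 ^ s" "s > 0" and frob: "\<And>a::'a. a ^ q = a"
    and deg: "degree M = 2 * m"
    and sym: "\<And>j. j \<le> m \<Longrightarrow> coeff M (m + j) = coeff M (m - j)"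
    and mid: "coeff M m = 0"
  shows "fpoly q m M ^ q - fpoly q m M = monom 1 (q ^ m) * linearized q M"
proof -
  have char_poly: "(2::'a poly) = 0" using char by (simp add: numeral_poly)
  note fd_sum = power_sum_char_two[OF char_poly, of _ _ s, folded q(1)]
  note fd_add = power_add_char_two[OF char_poly, of _ _ s, folded q(1)]
  define c where "c = coeff M"
  define T where "T = (\<lambda>j l. monom (c (m - j)) ((q ^ m + q ^ (m - j)) * q ^ l))"
  define f where "f = (\<Sum>j=1..m. \<Sum>l<j. T j l)"
  have q1: "q > 0" using q by simp
  have "T j l ^ q = T j (Suc l)" for j l
    by (simp add: T_def monom_power frob mult_ac)
  then have "f ^ q - f = (\<Sum>j=1..m. (\<Sum>l<j. T j (Suc l)) - (\<Sum>l<j. T j l))"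
    by (simp add: f_def fd_sum sum_subtractf)
  also have "\<dots> = (\<Sum>j=1..m. T j j - T j 0)"
    unfolding sum_subtractf[symmetric] sum_lessThan_telescope ..
  also have "\<dots> = (\<Sum>j=1..m. monom 1 (q ^ m) * (monom (c (m - j)) (q ^ (m - j)) + monom (c (m + j)) (q ^ (m + j))))"
  proof (rule sum.cong)
    fix j assume j: "j \<in> {1..m}"
    have "(q ^ m + q ^ (m - j)) * q ^ j = q ^ m + q ^ (m + j)"
      using j by (simp add: distrib_right power_add[symmetric])
    moreover have "c (m + j) = c (m - j)" using sym j by (simp add: c_def)
    moreover have "T j j - T j 0 = T j 0 + T j j"
      using uminus_char_two[OF char_poly, of "T j 0"] by (simp add: diff_conv_add_uminus del: add_uminus_conv_diff)
    ultimately show "T j j - T j 0 = monom 1 (q ^ m) * (monom (c (m - j)) (q ^ (m - j)) + monom (c (m + j)) (q ^ (m + j)))"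
      by (simp add: T_def mult_monom distrib_left)
  qed simp
  also have "\<dots> = monom 1 (q ^ m) * linearized q M"
    unfolding linearized_def deg sum_symmetric_split sum_distrib_left[symmetric] using mid by (simp add: c_def)
  finally have f: "f ^ q - f = monom 1 (q ^ m) * linearized q M" .
  have "coeff (T j l) 0 = 0" for j l using q1 by (simp add: T_def)
  then have f0: "coeff f 0 = 0" by (simp add: f_def coeff_sum)
  have unique: "g = f" if g: "coeff g 0 = 0" "g ^ q - g = monom 1 (q ^ m) * linearized q M" for g
  proof -
    define d where "d = g - f"
    have "g ^ q = (d + f) ^ q" by (simp add: d_def)
    also have "\<dots> = d ^ q + f ^ q" by (rule fd_add)
    finally have "d ^ q = d" using f g(2) by (simp add: d_def algebra_simps)
    moreover have "degree (d ^ q) = q * degree d"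
      by (cases "d = 0") (use q1 in \<open>simp_all add: degree_power_eq power_0_left\<close>)
    ultimately have "q * degree d = degree d" by metis
    moreover have "q \<ge> 2" using q by (simp add: self_le_power)
    ultimately have "degree d = 0" by simp
    moreover have "coeff d 0 = 0" using g f0 by (simp add: d_def)
    ultimately have "d = 0" by (auto elim!: degree_eq_zeroE)
    then show ?thesis by (simp add: d_def)
  qed
  have "fpoly q m M = f" unfolding fpoly_def
  proof (rule the_equality)
    show "coeff f 0 = 0 \<and> f ^ q - f = monom 1 (q ^ m) * linearized q M" using f f0 by simp
    show "g = f" if "coeff g 0 = 0 \<and> g ^ q - g = monom 1 (q ^ m) * linearized q M" for g
      using unique that by simp
  qed
  then show ?thesis using f by simp
qed

section \<open>The Frobenius map on the roots of an additive polynomial\<close>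

text \<open>Translation by \<open>1\<close> permutes the field, so comparing the sum of all elements
  with its translate shows that the cardinality vanishes in the field.\<close>

lemma card_eq_power_two_imp_char_two:
  assumes "card (UNIV :: 'a::{field,finite} set) = 2 ^ s"
  shows "(2::'a) = 0"
proof -
  have "(\<Sum>x\<in>UNIV. x) = (\<Sum>x\<in>UNIV. x + (1::'a))"
    by (rule sum.reindex_bij_witness[of _ "\<lambda>x. x + 1" "\<lambda>x. x - 1"]) auto
  then have "of_nat (card (UNIV :: 'a set)) = (0::'a)" by (simp add: sum.distrib)
  then show ?thesis unfolding assms by simp
qed

text \<open>Multiplication by a nonzero \<open>a\<close> permutes the nonzero elements; compare
  their products.\<close>

lemma power_card_UNIV_eq_self:
  fixes a :: "'a::{field,finite}"
  shows "a ^ card (UNIV :: 'a set) = a"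
proof (cases "a = 0")
  case False
  define U where "U = UNIV - {0::'a}"
  have "(\<Prod>x\<in>U. x) = (\<Prod>x\<in>U. a * x)"
    by (rule prod.reindex_bij_witness[of _ "\<lambda>x. a * x" "\<lambda>x. x / a"]) (use False in \<open>auto simp: U_def\<close>)
  then have "(\<Prod>x\<in>U. x) = a ^ card U * (\<Prod>x\<in>U. x)" by (simp add: prod.distrib)
  moreover have "(\<Prod>x\<in>U. x) \<noteq> 0" by (simp add: U_def)
  ultimately have "a ^ card U = 1" by simp
  moreover have "card (UNIV :: 'a set) = Suc (card U)"
    unfolding U_def by (rule card_Suc_Diff1[symmetric]) auto
  ultimately show ?thesis by simp
qed (simp add: card_gt_0_iff)

locale finite_subfield = field_hom \<epsilon> for \<epsilon> :: "'a::{field,finite} \<Rightarrow> 'K::field" +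
  fixes q s :: nat
  assumes card_q: "card (UNIV :: 'a set) = q" and q_eq: "q = 2 ^ s"
begin

lemma char_base: "(2::'a) = 0"
  using card_eq_power_two_imp_char_two card_q q_eq by metis

lemma char: "(2::'K) = 0"
  using char_base by (metis hom_numeral hom_zero)

lemma s_pos: "s > 0"
proof (rule ccontr)
  assume "\<not> s > 0"
  then have "card (UNIV :: 'a set) = 1" using card_q q_eq by simp
  then show False by (metis card_1_singletonE UNIV_I singletonD zero_neq_one)
qed

lemma q_ge: "q \<ge> 2"
  using s_pos unfolding q_eq by (simp add: self_le_power)

lemma q_pos: "q > 0"
  using q_ge by simp

lemma power_q: "(a::'a) ^ q = a"
  using power_card_UNIV_eq_self[of a] card_q by simp

lemma eps_power_q: "\<epsilon> a ^ q = \<epsilon> a"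
  by (metis hom_power power_q)

lemma eps_power_qi: "\<epsilon> a ^ (q ^ i) = \<epsilon> a"
  by (induction i) (simp_all add: power_mult eps_power_q)

lemma qi_eq: "q ^ i = 2 ^ (s * i)"
  by (simp add: q_eq power_mult)

lemma power_qi_add: "(x + y :: 'K) ^ (q ^ i) = x ^ (q ^ i) + y ^ (q ^ i)"
  unfolding qi_eq by (rule power_add_char_two[OF char])

lemma power_q_add: "(x + y :: 'K) ^ q = x ^ q + y ^ q"
  using power_qi_add[of x y 1] by simp

lemma power_q_sum: "(\<Sum>i\<in>A. f i :: 'K) ^ q = (\<Sum>i\<in>A. f i ^ q)"
  unfolding q_eq by (rule power_sum_char_two[OF char])

lemma inj_power_qi: "x ^ (q ^ i) = (y::'K) ^ (q ^ i) \<Longrightarrow> x = y"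
  using inj_power_char_two[OF char qi_eq, of i] by (auto dest: injD)

lemma diff_eq_add: "x - y = x + (y::'K)"
  using uminus_char_two[OF char, of y] by (simp add: diff_conv_add_uminus del: add_uminus_conv_diff)

text \<open>The polynomial \<open>x ^ q - x\<close> has at most \<open>q\<close> roots, and the
  \<open>q\<close> elements of the image of \<open>\<epsilon>\<close> are among them.\<close>

lemma fixed_iff: "x ^ q = x \<longleftrightarrow> x \<in> range \<epsilon>"
proof -
  define p where "p = monom 1 q - monom (1::'K) 1"
  have "coeff p q = 1" using q_ge by (simp add: p_def)
  then have p0: "p \<noteq> 0" by auto
  have "degree p \<le> q" unfolding p_def using q_ge by (intro degree_diff_le) (simp_all add: degree_monom_eq)
  then have "card {x. poly p x = 0} \<le> q" using card_poly_roots_bound[OF p0] by simp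
  moreover have roots: "{x. poly p x = 0} = {x. x ^ q = x}" by (auto simp: p_def poly_monom)
  moreover have "range \<epsilon> \<subseteq> {x. x ^ q = x}" using eps_power_q by auto
  moreover have "card (range \<epsilon>) = q" using card_q inj_f by (metis card_image)
  ultimately have "range \<epsilon> = {x. x ^ q = x}" using poly_roots_finite[OF p0] by (intro card_seteq) auto
  then show ?thesis by auto
qed

text \<open>The operator \<open>p(F)\<close> for the \<open>q\<close>-th power map \<open>F\<close>
  on \<open>K\<close>.\<close>

definition lin :: "'a poly \<Rightarrow> 'K \<Rightarrow> 'K" where
  "lin p x = (\<Sum>i\<le>degree p. \<epsilon> (coeff p i) * x ^ (q ^ i))"

lemma lin_ge: "degree p \<le> n \<Longrightarrow> lin p x = (\<Sum>i\<le>n. \<epsilon> (coeff p i) * x ^ (q ^ i))"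
  unfolding lin_def by (rule sum.mono_neutral_left) (auto simp: coeff_eq_0)

lemma lin_pCons: "lin (pCons a p) x = \<epsilon> a * x + lin p (x ^ q)"
proof -
  have "lin (pCons a p) x = (\<Sum>i\<le>Suc (degree p). \<epsilon> (coeff (pCons a p) i) * x ^ (q ^ i))"
    by (rule lin_ge) (rule degree_pCons_le)
  also have "\<dots> = \<epsilon> a * x + (\<Sum>i\<le>degree p. \<epsilon> (coeff p i) * x ^ (q ^ Suc i))"
    by (subst sum.atMost_Suc_shift) simp
  also have "(\<Sum>i\<le>degree p. \<epsilon> (coeff p i) * x ^ (q ^ Suc i)) = lin p (x ^ q)"
    by (simp add: lin_def power_mult)
  finally show ?thesis .
qed

lemma lin_poly_0: "lin 0 x = 0"
  by (simp add: lin_def)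

lemma lin_add_poly: "lin (p + r) x = lin p x + lin r x"
proof -
  define n where "n = max (degree p) (degree r)"
  have "degree (p + r) \<le> n" "degree p \<le> n" "degree r \<le> n"
    using degree_add_le_max[of p r] by (auto simp: n_def)
  then show ?thesis by (simp add: lin_ge hom_distribs distrib_right sum.distrib)
qed

lemma lin_smult: "lin (Polynomial.smult a p) x = \<epsilon> a * lin p x"
  using lin_ge[OF degree_smult_le, of a p x]
  by (simp add: lin_def hom_distribs sum_distrib_left mult.assoc)

lemma lin_power_q: "lin p (x ^ q) = lin p x ^ q"
  by (simp add: lin_def power_q_sum power_mult_distrib eps_power_q power_mult[symmetric] mult.commute)

text \<open>Products become compositions because \<open>F\<close> fixes the coefficients and so
  commutes with every \<open>lin p\<close>.\<close>

lemma lin_mult: "lin (p * r) x = lin p (lin r x)"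
proof (induction p arbitrary: x)
  case (pCons a p)
  have "lin (pCons a p * r) x = \<epsilon> a * lin r x + lin (p * r) (x ^ q)"
    by (simp add: lin_add_poly lin_smult lin_pCons)
  then show ?case by (simp add: pCons.IH lin_power_q lin_pCons)
qed (simp add: lin_poly_0)

lemma lin_scale: "lin p (\<epsilon> a * x) = \<epsilon> a * lin p x"
  by (simp add: lin_def power_mult_distrib eps_power_qi sum_distrib_left mult_ac)

lemma lin_eps: "lin p (\<epsilon> a) = \<epsilon> (poly p 1) * \<epsilon> a"
  by (simp add: lin_def eps_power_qi poly_altdef hom_distribs sum_distrib_right)

lemma lin_monom: "lin (monom 1 k) x = x ^ (q ^ k)"
  by (simp add: lin_def degree_monom_eq if_distrib[of \<epsilon>] if_distrib[of "\<lambda>y. y * _"] cong: if_cong)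

lemma lin_X_minus_1: "lin [:- 1, 1:] x = x ^ q - x"
  by (simp add: lin_pCons lin_poly_0 hom_distribs)

lemma lin_eq_poly: "lin p x = poly (additive_poly q (degree p) (\<lambda>i. \<epsilon> (coeff p i))) x"
  by (simp add: lin_def poly_additive_poly)

lemma finite_kernel_lin:
  assumes "p \<noteq> 0"
  shows "finite {x. lin p x = 0}" "card {x. lin p x = 0} \<le> q ^ degree p"
proof -
  have deg: "degree (additive_poly q (degree p) (\<lambda>i. \<epsilon> (coeff p i))) = q ^ degree p"
    using assms q_ge by (intro degree_additive_poly) auto
  moreover have "q ^ degree p > 0" using q_pos by simp
  ultimately have "additive_poly q (degree p) (\<lambda>i. \<epsilon> (coeff p i)) \<noteq> 0" by (metis degree_0 less_irrefl)
  then show "finite {x. lin p x = 0}" "card {x. lin p x = 0} \<le> q ^ degree p"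
    unfolding lin_eq_poly using card_poly_roots_bound poly_roots_finite deg by fastforce+
qed

end

text \<open>Strip one linear factor from both polynomials; simplicity ensures that the stripped root
  does not recur in the cofactor of \<open>p\<close>.\<close>

lemma simple_roots_dvd:
  fixes p t :: "'b::field poly"
  assumes "alg_closed_type TYPE('b)" "p \<noteq> 0"
    and "\<And>z. poly p z = 0 \<Longrightarrow> order z p = 1" "\<And>z. poly p z = 0 \<Longrightarrow> poly t z = 0"
  shows "p dvd t"
  using assms(2-)
proof (induction "degree p" arbitrary: p t)
  case 0
  then show ?case by (metis is_unit_iff_degree unit_imp_dvd)
next
  case (Suc n)
  then obtain z where z: "poly p z = 0" using assms(1) unfolding alg_closed_type_def by (metis zero_less_Suc)
  then obtain r where p: "p = [:- z, 1:] * r" using poly_eq_0_iff_dvd[of p z] by (auto elim: dvdE)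
  obtain t' where t: "t = [:- z, 1:] * t'"
    using Suc.prems(3)[OF z] poly_eq_0_iff_dvd[of t z] by (auto elim: dvdE)
  have r0: "r \<noteq> 0" using Suc.prems p by auto
  have deg: "degree p = Suc (degree r)" unfolding p using r0 by (subst degree_mult_eq) auto
  have ord: "order w p = order w [:- z, 1:] + order w r" for w
    unfolding p using Suc.prems(1) p by (intro order_mult) auto
  have "order z [:- z, 1:] = 1" using order_power_n_n[of z 1] by simp
  then have rz: "poly r z \<noteq> 0" using ord[of z] Suc.prems(2)[OF z] r0 order_root[of r z] by simp
  have "r dvd t'"
  proof (rule Suc.hyps(1))
    show "n = degree r" "r \<noteq> 0" using Suc.hyps(2) deg r0 by auto
    fix w assume w: "poly r w = 0"
    then have pw: "poly p w = 0" by (simp add: p)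
    have "w \<noteq> z" using rz w by auto
    then show "poly t' w = 0" using Suc.prems(3)[OF pw] by (auto simp: t)
    have "order w [:- z, 1:] = 0" using \<open>w \<noteq> z\<close> by (intro order_0I) simp
    then show "order w r = 1" using ord[of w] Suc.prems(2)[OF pw] by simp
  qed
  then show ?case unfolding p t by (rule mult_dvd_mono[OF dvd_refl])
qed

section \<open>Periods of Frobenius and the image of \<open>F^k - 1\<close>\<close>

context finite_subfield
begin

lemma poly_map_poly_power_q: "poly (map_poly \<epsilon> p) (z ^ q) = poly (map_poly \<epsilon> p) z ^ q"
  by (simp add: poly_altdef power_q_sum power_mult_distrib eps_power_q power_mult[symmetric] mult.commute)

text \<open>The \<open>q\<close>-th power map sends the finite root set to itself, so two iterates
  agree at each root, and injectivity turns this into a period. The product of the periods is a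
  common one.\<close>

lemma eventually_fixed_roots:
  assumes "p \<noteq> 0"
  shows "\<exists>R>0. \<forall>z. poly (map_poly \<epsilon> p) z = 0 \<longrightarrow> z ^ (q ^ R) = z"
proof -
  define Z where "Z = {z. poly (map_poly \<epsilon> p) z = 0}"
  have fin: "finite Z" unfolding Z_def using assms by (intro poly_roots_finite) simp
  have "\<exists>r>0. z ^ (q ^ r) = z" if "z \<in> Z" for z
  proof -
    have "z ^ (q ^ i) \<in> Z" for i
      using that by (induction i) (simp_all add: Z_def power_mult mult.commute[of q] poly_map_poly_power_q q_pos)
    then have "range (\<lambda>i. z ^ (q ^ i)) \<subseteq> Z" by auto
    then have "\<not> inj (\<lambda>i. z ^ (q ^ i))" using fin finite_subset finite_imageD infinite_UNIV_nat by blast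
    then obtain i j where ij: "i < j" "z ^ (q ^ i) = z ^ (q ^ j)"
      by (metis (no_types, lifting) injI linorder_neqE_nat)
    then have "(z ^ (q ^ (j - i))) ^ (q ^ i) = z ^ (q ^ i)"
      by (simp add: power_mult[symmetric] power_add[symmetric])
    then have "z ^ (q ^ (j - i)) = z" by (rule inj_power_qi)
    then show ?thesis using ij by (intro exI[of _ "j - i"]) simp
  qed
  then obtain r where r: "\<And>z. z \<in> Z \<Longrightarrow> r z > 0" "\<And>z. z \<in> Z \<Longrightarrow> z ^ (q ^ r z) = z" by metis
  define R where "R = (\<Prod>z\<in>Z. r z)"
  have "z ^ (q ^ R) = z" if z: "z \<in> Z" for z
  proof -
    have "z ^ (q ^ (r z * n)) = z" for n
      by (induction n) (simp_all add: power_add power_mult r(2)[OF z])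
    moreover have "r z dvd R" unfolding R_def by (rule dvd_prodI[OF fin z])
    ultimately show ?thesis by auto
  qed
  moreover have "R > 0" unfolding R_def using r(1) by (intro prod_pos) auto
  ultimately show ?thesis by (auto simp: Z_def)
qed

text \<open>Let \<open>F\<close> be the \<open>q\<close>-th power map, \<open>M = (x - 1)P\<close> and \<open>x\<^sup>k - 1 = PU\<close> with \<open>k\<close> odd. For \<open>w\<close> in the
  kernel of \<open>M(F)\<close>, the element \<open>P(F)w\<close> is fixed by \<open>F\<close>, hence \<open>(F\<^sup>k - 1)w = U(1)P(F)w\<close> with
  \<open>U(1) \<noteq> 0\<close>.\<close>

lemma image_frobenius_power_minus_id:
  fixes M :: "'a poly"
  assumes closed: "alg_closed_type TYPE('K)" and M0: "coeff M 0 \<noteq> 0" and ord: "Polynomial.order 1 M = 2"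
    and simple: "\<forall>z. poly (map_poly \<epsilon> (M div [:- 1, 1:] ^ 2)) z = 0 \<longrightarrow>
      Polynomial.order z (map_poly \<epsilon> (M div [:- 1, 1:] ^ 2)) = 1"
  shows "\<exists>k. {w ^ (q ^ k) - w | w. lin M w = 0} = range \<epsilon>"
proof -
  define X1 where "X1 = [:- 1, 1 :: 'a:]"
  define N where "N = M div X1 ^ 2"
  have "M \<noteq> 0" using M0 by auto
  have M: "M = X1 ^ 2 * N"
    using order_1[of 1 M] ord by (simp add: N_def X1_def)
  \<comment> \<open>Here the multiplicity of \<open>1\<close> being exactly two enters.\<close>
  have N1: "poly N 1 \<noteq> 0"
  proof
    assume "poly N 1 = 0"
    then obtain N' where "N = X1 * N'" by (auto simp: poly_eq_0_iff_dvd X1_def elim: dvdE)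
    then have "X1 ^ 3 dvd M" by (simp add: M power3_eq_cube power2_eq_square mult.assoc)
    then show False using order_2[OF \<open>M \<noteq> 0\<close>, of 1] ord by (simp add: X1_def numeral_3_eq_3 numeral_2_eq_2)
  qed
  have N0: "poly N 0 \<noteq> 0" using M0 by (simp add: M poly_0_coeff_0[symmetric])
  then have Nnz: "N \<noteq> 0" by auto
  obtain R where R: "R > 0" "\<And>z. poly (map_poly \<epsilon> N) z = 0 \<Longrightarrow> z ^ (q ^ R) = z"
    using eventually_fixed_roots[OF Nnz] by blast
  \<comment> \<open>Roots of \<open>N\<close> are nonzero and satisfy
    \<open>z ^ (q ^ R) = z\<close>, hence \<open>z ^ k = 1\<close>; and \<open>k\<close> is odd
    since \<open>q ^ R\<close> is even.\<close>
  define k where "k = q ^ R - 1"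
  have k: "q ^ R = Suc k" using q_pos by (simp add: k_def)
  have kodd: "(of_nat k :: 'a) \<noteq> 0"
  proof
    assume "(of_nat k :: 'a) = 0"
    then have "(of_nat (q ^ R) :: 'a) = 1" by (simp add: k)
    moreover have "(of_nat (q ^ R) :: 'a) = 0"
      using R(1) s_pos char_base by (simp add: q_eq power_0_left)
    ultimately show False by simp
  qed
  define T where "T = monom 1 k + [:- 1 :: 'a:]"
  define P where "P = X1 * N"
  have P: "map_poly \<epsilon> P = [:- 1, 1:] * map_poly \<epsilon> N"
  proof -
    interpret map_hom: map_poly_comm_ring_hom \<epsilon> ..
    show ?thesis unfolding P_def X1_def map_hom.hom_mult by (simp add: hom_distribs)
  qed
  have PKnz: "map_poly \<epsilon> P \<noteq> 0" unfolding P using Nnz by (simp del: mult_pCons_left)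
  have "map_poly \<epsilon> P dvd map_poly \<epsilon> T"
  proof (rule simple_roots_dvd[OF closed PKnz])
    fix z assume z: "poly (map_poly \<epsilon> P) z = 0"
    have o: "Polynomial.order z (map_poly \<epsilon> P) = Polynomial.order z [:- 1, 1:] + Polynomial.order z (map_poly \<epsilon> N)"
      using PKnz unfolding P by (rule order_mult)
    have NK1: "poly (map_poly \<epsilon> N) 1 \<noteq> 0"
      using N1 poly_map_poly[of N 1] by simp
    show "Polynomial.order z (map_poly \<epsilon> P) = 1"
    proof (cases "z = 1")
      case True
      have "Polynomial.order 1 [:- 1, 1 :: 'K:] = 1" using order_power_n_n[of "1::'K" 1] by simp
      moreover have "Polynomial.order 1 (map_poly \<epsilon> N) = 0" using NK1 by (rule order_0I)
      ultimately show ?thesis using o True by simp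
    next
      case False
      then have "Polynomial.order z [:- 1, 1:] = 0" by (intro order_0I) simp
      moreover have "poly (map_poly \<epsilon> N) z = 0" using z False by (simp add: P)
      ultimately show ?thesis using simple o by (simp add: N_def X1_def)
    qed
    have "z ^ k = 1"
    proof (cases "z = 1")
      case False
      then have zN: "poly (map_poly \<epsilon> N) z = 0" using z by (simp add: P)
      then have "z * z ^ k = z" using R(2) k by simp
      moreover have "z \<noteq> 0" using zN N0 poly_map_poly[of N 0] by auto
      ultimately show ?thesis by simp
    qed simp
    then show "poly (map_poly \<epsilon> T) z = 0"
      by (simp add: T_def hom_distribs poly_monom map_poly_monom)
  qed
  then have "P dvd T" by (rule dvd_map_poly_hom_imp_dvd)
  then obtain U where T: "T = P * U" by (rule dvdE)
  \<comment> \<open>Differentiating \<open>x^k - 1 = (x - 1) * N * U\<close> at \<open>1\<close>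
    gives \<open>k = N(1) * U(1)\<close>.\<close>
  have U1: "poly U 1 \<noteq> 0"
  proof -
    have "poly (pderiv T) 1 = of_nat k" by (simp add: T_def pderiv_add pderiv_monom poly_monom pderiv_pCons)
    moreover have "poly (pderiv T) 1 = poly (N * U) 1"
      unfolding T P_def X1_def mult.assoc pderiv_mult by (simp add: pderiv_pCons)
    ultimately show ?thesis using kodd by auto
  qed
  have linT: "lin T w = w ^ (q ^ k) - w" for w
    by (simp add: T_def lin_add_poly lin_monom lin_pCons lin_poly_0 hom_distribs)
  have MP: "M = X1 * P" by (simp add: M P_def power2_eq_square mult.assoc)
  have fixed: "lin P w \<in> range \<epsilon>" if "lin M w = 0" for w
  proof -
    have "lin P w ^ q = lin P w" using that unfolding MP lin_mult X1_def lin_X_minus_1 by simp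
    then show ?thesis by (simp only: fixed_iff)
  qed
  have linTP: "lin T w = \<epsilon> (poly U 1) * lin P w" if "lin M w = 0" for w
  proof -
    obtain a where "lin P w = \<epsilon> a" using fixed \<open>lin M w = 0\<close> by blast
    then show ?thesis unfolding T mult.commute[of P U] lin_mult by (simp add: lin_eps)
  qed
  \<comment> \<open>By counting: the kernel of \<open>lin M\<close> has \<open>q ^ degree M\<close>
    elements, that of \<open>lin P\<close> at most \<open>q ^ degree P\<close>, and
    \<open>degree P\<close> is smaller by one.\<close>
  have "\<exists>w. lin M w = 0 \<and> lin P w \<noteq> 0"
  proof (rule ccontr)
    assume "\<not> ?thesis"
    then have "{w. lin M w = 0} \<subseteq> {w. lin P w = 0}" by auto
    moreover have "P \<noteq> 0" using PKnz by auto
    ultimately have "card {w. lin M w = 0} \<le> q ^ degree P"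
      using finite_kernel_lin[of P] card_mono order_trans by blast
    moreover have "card {w. lin M w = 0} = q ^ degree M"
      unfolding lin_eq_poly using \<open>M \<noteq> 0\<close> M0
      by (intro card_roots_additive_poly[OF closed char q_eq s_pos]) auto
    moreover have "degree M = Suc (degree P)"
      unfolding MP using \<open>P \<noteq> 0\<close> by (subst degree_mult_eq) (auto simp: X1_def)
    moreover have "q ^ degree P < q ^ Suc (degree P)" using q_ge by (intro power_strict_increasing) auto
    ultimately show False by simp
  qed
  then obtain w b where w: "lin M w = 0" "lin P w = \<epsilon> b" "b \<noteq> 0" using fixed by fastforce
  have "{w ^ (q ^ k) - w | w. lin M w = 0} = range \<epsilon>"
  proof (intro equalityI subsetI)
    fix x assume "x \<in> {w ^ (q ^ k) - w | w. lin M w = 0}"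
    then obtain v where v: "x = lin T v" "lin M v = 0" by (auto simp: linT)
    then obtain a where "lin P v = \<epsilon> a" using fixed by blast
    then have "x = \<epsilon> (poly U 1 * a)" using v linTP by (simp add: hom_distribs)
    then show "x \<in> range \<epsilon>" by blast
  next
    fix x assume "x \<in> range \<epsilon>"
    then obtain a where a: "x = \<epsilon> a" by blast
    \<comment> \<open>The scalar makes \<open>lin T v = U(1) * lin P v\<close> equal to
      \<open>\<epsilon> a\<close>, since \<open>lin P w = \<epsilon> b\<close>.\<close>
    define v where "v = \<epsilon> (a / (poly U 1 * b)) * w"
    have v: "lin M v = 0" by (simp add: v_def lin_scale w)
    have "lin T v = \<epsilon> (poly U 1 * (a / (poly U 1 * b)) * b)"
      unfolding linTP[OF v] unfolding v_def lin_scale w(2) hom_mult by (simp only: mult.assoc)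
    also have "poly U 1 * (a / (poly U 1 * b)) * b = a" using U1 w by simp
    finally have "x = v ^ (q ^ k) - v" by (simp add: a linT)
    then show "x \<in> {w ^ (q ^ k) - w | w. lin M w = 0}" using v by blast
  qed
  then show ?thesis by blast
qed

end

section \<open>Homomorphisms defined on a subfield\<close>

locale subfield_hom =
  fixes E :: "'k::field set" and h :: "'k \<Rightarrow> 'l::field"
  assumes sub: "is_subfield E"
    and hom_add: "x \<in> E \<Longrightarrow> y \<in> E \<Longrightarrow> h (x + y) = h x + h y"
    and hom_mult: "x \<in> E \<Longrightarrow> y \<in> E \<Longrightarrow> h (x * y) = h x * h y"
    and hom_one: "h 1 = 1"
begin

lemma closed: "0 \<in> E" "1 \<in> E" "x \<in> E \<Longrightarrow> y \<in> E \<Longrightarrow> x + y \<in> E" "x \<in> E \<Longrightarrow> y \<in> E \<Longrightarrow> x - y \<in> E"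
  "x \<in> E \<Longrightarrow> y \<in> E \<Longrightarrow> x * y \<in> E" "x \<in> E \<Longrightarrow> inverse x \<in> E"
  using sub by (auto simp: is_subfield_def)

lemma closed_uminus: "x \<in> E \<Longrightarrow> - x \<in> E"
  using closed(4)[OF closed(1), of x] by simp

lemma closed_sum: "(\<And>i. i \<in> A \<Longrightarrow> f i \<in> E) \<Longrightarrow> (\<Sum>i\<in>A. f i) \<in> E"
  by (induction A rule: infinite_finite_induct) (auto intro: closed)

lemma closed_power: "x \<in> E \<Longrightarrow> x ^ n \<in> E"
  by (induction n) (auto intro: closed)

lemma hom_zero: "h 0 = 0"
  using hom_add[OF closed(1,1)] by (metis add_cancel_right_right)

lemma hom_uminus: "x \<in> E \<Longrightarrow> h (- x) = - h x"
  using hom_add[of x "- x"] hom_zero by (simp add: closed_uminus eq_neg_iff_add_eq_0 add.commute)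

lemma hom_diff: "x \<in> E \<Longrightarrow> y \<in> E \<Longrightarrow> h (x - y) = h x - h y"
  using hom_add[of x "- y"] by (simp add: closed_uminus hom_uminus)

lemma hom_power: "x \<in> E \<Longrightarrow> h (x ^ n) = h x ^ n"
  by (induction n) (simp_all add: hom_one hom_mult closed_power)

lemma hom_sum: "(\<And>i. i \<in> A \<Longrightarrow> f i \<in> E) \<Longrightarrow> h (\<Sum>i\<in>A. f i) = (\<Sum>i\<in>A. h (f i))"
  by (induction A rule: infinite_finite_induct) (simp_all add: hom_zero hom_add closed_sum)

lemma hom_inverse: "x \<in> E \<Longrightarrow> h (inverse x) = inverse (h x)"
proof (cases "x = 0")
  case False
  assume "x \<in> E"
  then have "h x * h (inverse x) = 1" using False hom_mult[of x "inverse x"] by (simp add: closed hom_one)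
  then show ?thesis by (rule inverse_unique[symmetric])
qed (simp add: hom_zero)

lemma hom_eq_0_iff: "x \<in> E \<Longrightarrow> h x = 0 \<longleftrightarrow> x = 0"
proof -
  assume x: "x \<in> E"
  have "x = 0" if "h x = 0"
  proof (rule ccontr)
    assume "x \<noteq> 0"
    then have "h x * h (inverse x) = 1" using x hom_mult[of x "inverse x"] by (simp add: closed hom_one)
    then show False using that by simp
  qed
  then show ?thesis using hom_zero by auto
qed

lemma inj_on_E: "inj_on h E"
proof (rule inj_onI)
  fix x y assume "x \<in> E" "y \<in> E" "h x = h y"
  then have "h (x - y) = 0" by (simp add: hom_diff)
  then show "x = y" using \<open>x \<in> E\<close> \<open>y \<in> E\<close> by (simp add: hom_eq_0_iff closed)
qed

lemma closed_poly:
  assumes "\<And>c. g c \<in> E" "g 0 = 0" "z \<in> E"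
  shows "poly (map_poly g p) z \<in> E"
  by (induction p) (simp_all add: map_poly_pCons assms closed)

lemma hom_poly:
  assumes "\<And>c. g c \<in> E" "g 0 = 0" "z \<in> E"
  shows "h (poly (map_poly g p) z) = poly (map_poly (\<lambda>c. h (g c)) p) (h z)"
  by (induction p)
    (simp_all add: map_poly_pCons assms hom_zero hom_add hom_mult closed closed_poly[where g = g and z = z, OF assms])

end

section \<open>Auxiliary facts on the splitting field, constant terms and fractions\<close>

lemma is_subfield_splitE: "is_subfield (splitE e q m M)"
  unfolding splitE_def is_subfield_def by auto

lemma splitE_least: "is_subfield S \<Longrightarrow> range e \<subseteq> S \<Longrightarrow> rootsL e q m M \<subseteq> S \<Longrightarrow> splitE e q m M \<subseteq> S"
  unfolding splitE_def by blast

lemma fls_nth_mult_0: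
  fixes f g :: "'k::field fls"
  assumes "fls_subdegree f \<ge> 0" "fls_subdegree g \<ge> 0"
  shows "fls_nth (f * g) 0 = fls_nth f 0 * fls_nth g 0"
proof -
  obtain F G where "f = fps_to_fls F" "g = fps_to_fls G"
    using fls_regpart_to_fls_trivial assms by metis
  then show ?thesis by (simp flip: fls_times_fps_to_fls)
qed

lemma fps_to_fls_sum: "fps_to_fls (\<Sum>i\<in>A. f i) = (\<Sum>i\<in>A. fps_to_fls (f i))"
  by (induction A rule: infinite_finite_induct) simp_all

lemma comm_ring_hom_poly_fr: "comm_ring_hom (poly_fr :: 'a::field poly \<Rightarrow> _)"
  by unfold_locales (simp_all add: poly_fr_def Zero_fract_def One_fract_def eq_fract)

lemma fract_eq_poly_fr_quotient: "\<exists>P Q. Q \<noteq> 0 \<and> x = poly_fr P / poly_fr Q"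
proof (cases x rule: Fract_cases)
  case (Fract P Q)
  then show ?thesis by (intro exI[of _ P] exI[of _ Q]) (simp add: poly_fr_def)
qed

section \<open>The embedding into Laurent series\<close>

locale frobenius_setup =
  fixes M :: "'a::{field,finite} poly" and q s m :: nat and e :: "'a poly fract \<Rightarrow> 'K::field"
  assumes card_q: "card (UNIV :: 'a set) = q" and q_eq: "q = 2 ^ s"
    and m_ge: "m \<ge> 2" and deg: "degree M = 2 * m"
    and monic: "lead_coeff M = 1" and const1: "coeff M 0 = 1"
    and emb: "field_emb e" and alg_closed: "alg_closed_type TYPE('K)"
begin

definition \<epsilon> :: "'a \<Rightarrow> 'K" where "\<epsilon> c = e (const_fr c)"
definition \<pi> :: "'a poly \<Rightarrow> 'K" where "\<pi> P = e (poly_fr P)"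
text \<open>The counterpart of \<open>\<pi>\<close>: F_q[t] inside Laurent series, with
  \<open>t\<close> going to the variable.\<close>

definition \<iota> :: "'a poly \<Rightarrow> 'K fls" where "\<iota> P = fps_to_fls (fps_of_poly (map_poly \<epsilon> P))"

lemma e_comp: "e \<circ> const_fr = \<epsilon>" "e \<circ> poly_fr = \<pi>"
  by (auto simp: \<epsilon>_def \<pi>_def)

lemma e_field_hom: "field_hom e"
proof -
  have add: "e (x + y) = e x + e y" for x y using emb by (simp add: field_emb_def)
  have "e 0 = 0" using add[of 0 0] by (metis add_cancel_right_right)
  then show ?thesis using emb by unfold_locales (auto simp: field_emb_def)
qed

sublocale e: field_hom e by (rule e_field_hom)
sublocale pf: comm_ring_hom "poly_fr :: 'a poly \<Rightarrow> _" by (rule comm_ring_hom_poly_fr)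

lemma \<pi>_hom: "comm_ring_hom \<pi>"
  by unfold_locales (simp_all add: \<pi>_def pf.hom_add pf.hom_mult e.hom_add e.hom_mult)

sublocale \<pi>: comm_ring_hom \<pi> by (rule \<pi>_hom)

lemma \<epsilon>_eq: "\<epsilon> c = \<pi> [:c:]"
  by (simp add: \<epsilon>_def \<pi>_def const_fr_def poly_fr_def)

lemma \<epsilon>_field_hom: "field_hom \<epsilon>"
proof
  fix x y :: 'a
  show "\<epsilon> (x + y) = \<epsilon> x + \<epsilon> y" unfolding \<epsilon>_eq by (simp flip: \<pi>.hom_add)
  show "\<epsilon> (x * y) = \<epsilon> x * \<epsilon> y" unfolding \<epsilon>_eq by (simp add: mult.commute flip: \<pi>.hom_mult)
qed (simp_all add: \<epsilon>_eq flip: one_pCons)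

sublocale finite_subfield \<epsilon> q s
  using \<epsilon>_field_hom card_q q_eq by (intro finite_subfield.intro) (simp_all add: finite_subfield_axioms_def)

lemma \<iota>_hom: "comm_ring_hom \<iota>"
proof -
  interpret mp: map_poly_comm_ring_hom \<epsilon> ..
  show ?thesis
    by unfold_locales (simp_all add: \<iota>_def mp.hom_add mp.hom_mult fps_of_poly_add fps_of_poly_mult fls_times_fps_to_fls)
qed

sublocale \<iota>: comm_ring_hom \<iota> by (rule \<iota>_hom)

lemma \<pi>_eq_0_iff: "\<pi> P = 0 \<longleftrightarrow> P = 0"
  by (simp add: \<pi>_def poly_fr_def Zero_fract_def eq_fract)

lemma \<iota>_eq_0_iff: "\<iota> P = 0 \<longleftrightarrow> P = 0"
proof -
  have "fps_of_poly (map_poly \<epsilon> P) = 0 \<longleftrightarrow> map_poly \<epsilon> P = 0"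
    by (metis fps_of_poly_0 fps_of_poly_eq_iff)
  then show ?thesis by (simp add: \<iota>_def)
qed

lemma \<iota>_nth_0: "fls_nth (\<iota> P) 0 = \<epsilon> (coeff P 0)"
  by (simp add: \<iota>_def)

lemma \<iota>_subdegree: "fls_subdegree (\<iota> P) \<ge> 0"
  unfolding \<iota>_def by (rule fls_subdegree_fls_to_fps_gt0)

lemma e_quotient: "\<exists>P Q. Q \<noteq> 0 \<and> e x = \<pi> P / \<pi> Q"
proof -
  obtain P Q where "Q \<noteq> 0" "x = poly_fr P / poly_fr Q" using fract_eq_poly_fr_quotient by blast
  then show ?thesis
    by (intro exI[of _ P] exI[of _ Q]) (simp add: \<pi>_def divide_inverse e.hom_mult e.hom_inverse)
qed

text \<open>The coefficient of \<open>x^(q^i)\<close> in \<open>L\<close>, kept in F_q[t] so that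
  both \<open>\<pi>\<close> and \<open>\<iota>\<close> apply to it and the integrality of the roots
  is visible.\<close>

definition lc :: "nat \<Rightarrow> 'a poly" where
  "lc i = [:coeff M i:] + (if i = m + 1 then monom 1 q else 0) + (if i = m - 1 then [:0, 1:] else 0)"

text \<open>Since \<open>m \<ge> 2\<close>, the indices \<open>m - 1\<close> and
  \<open>m + 1\<close> lie strictly between \<open>0\<close> and \<open>2 * m\<close>, so the terms
  with \<open>t\<close> miss both end coefficients.\<close>

lemma lc_0: "lc 0 = 1"
  using m_ge const1 by (simp add: lc_def one_pCons)

lemma lc_top: "lc (2 * m) = 1"
  using m_ge monic deg by (simp add: lc_def one_pCons)

lemma coeff_lc_0: "coeff (lc i) 0 = coeff M i"
  using q_pos by (simp add: lc_def)

lemma Lpoly_eq: "Lpoly q m M = additive_poly q (2 * m) (\<lambda>i. poly_fr (lc i))"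
proof -
  have c: "const_fr c = poly_fr [:c:]" for c :: 'a by (simp add: const_fr_def poly_fr_def)
  have t: "tvar = poly_fr [:0, 1::'a:]" by (simp add: tvar_def poly_fr_def)
  have "tvar ^ q = poly_fr (monom (1::'a) q)"
    unfolding t pf.hom_power[symmetric] by (simp add: monom_altdef)
  moreover have "map_poly const_fr (linearized q M) = (\<Sum>i\<le>2 * m. monom (poly_fr [:coeff M i:]) (q ^ i))"
  proof (rule poly_eqI)
    fix n
    have c0: "const_fr 0 = (0 :: 'a poly fract)" by (simp add: c)
    have "const_fr (x + y) = const_fr x + const_fr (y :: 'a)" for x y
      unfolding c pf.hom_add[symmetric] by simp
    then have csum: "const_fr (\<Sum>i\<in>A. f i) = (\<Sum>i\<in>A. const_fr (f i :: 'a))" for A :: "nat set" and f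
      by (induction A rule: infinite_finite_induct) (simp_all add: c0)
    have "coeff (map_poly const_fr (linearized q M)) n = (\<Sum>i\<le>2 * m. const_fr (coeff (monom (coeff M i) (q ^ i)) n))"
      by (simp only: coeff_map_poly[of const_fr, OF c0] linearized_def deg coeff_sum csum)
    also have "\<dots> = (\<Sum>i\<le>2 * m. coeff (monom (poly_fr [:coeff M i:]) (q ^ i)) n)"
      by (rule sum.cong) (auto simp: c)
    finally show "coeff (map_poly const_fr (linearized q M)) n = coeff (\<Sum>i\<le>2 * m. monom (poly_fr [:coeff M i:]) (q ^ i)) n"
      by (simp only: coeff_sum)
  qed
  moreover have "monom (poly_fr (lc i)) (q ^ i) = monom (poly_fr [:coeff M i:]) (q ^ i)
      + (if i = m + 1 then monom (poly_fr (monom 1 q)) (q ^ i) else 0)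
      + (if i = m - 1 then monom (poly_fr [:0, 1:]) (q ^ i) else 0)" for i
    by (auto simp: lc_def pf.hom_add add_monom)
  ultimately show ?thesis
    using m_ge unfolding Lpoly_def additive_poly_def t by (simp add: sum.distrib)
qed

abbreviation V where "V \<equiv> rootsL e q m M"
abbreviation E where "E \<equiv> splitE e q m M"

lemma map_Lpoly: "map_poly e (Lpoly q m M) = additive_poly q (2 * m) (\<lambda>i. \<pi> (lc i))"
  unfolding Lpoly_eq by (rule poly_eqI)
    (simp add: coeff_map_poly coeff_additive_poly e.hom_sum \<pi>_def if_distrib[of e] cong: if_cong)

lemma V_eq: "V = {z. poly (additive_poly q (2 * m) (\<lambda>i. \<pi> (lc i))) z = 0}"
  unfolding rootsL_def map_Lpoly ..

lemma V_iff: "z \<in> V \<longleftrightarrow> (\<Sum>i\<le>2 * m. \<pi> (lc i) * z ^ (q ^ i)) = 0"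
  by (simp add: V_eq poly_additive_poly)

lemma card_V: "card V = q ^ (2 * m)"
  unfolding V_eq
  by (rule card_roots_additive_poly[OF alg_closed char q_eq s_pos]) (simp_all add: lc_0 lc_top)

lemma finite_V: "finite V"
  using card_V q_pos by (metis card.infinite less_irrefl zero_less_power)

lemma V_sub_E: "V \<subseteq> E" and range_e_sub_E: "range e \<subseteq> E"
  unfolding splitE_def by auto

lemma \<pi>_in_E: "\<pi> P \<in> E" and \<epsilon>_in_E: "\<epsilon> c \<in> E"
  using range_e_sub_E by (auto simp: \<pi>_def \<epsilon>_def)

text \<open>The roots of \<open>\<Phi>\<close>, which is the reduction of \<open>L\<close> at
  \<open>t = 0\<close>.\<close>

definition W :: "'K set" where "W = {w. lin M w = 0}"

lemma card_W: "card W = q ^ (2 * m)"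
  unfolding W_def lin_eq_poly deg[symmetric] using monic const1
  by (intro card_roots_additive_poly[OF alg_closed char q_eq s_pos]) auto

section \<open>Splitting of \<open>L\<close> over Laurent series and the embedding of
  \<open>E\<close>\<close>

definition L2 :: "'K fls poly" where "L2 = additive_poly q (2 * m) (\<lambda>i. \<iota> (lc i))"
definition V2 :: "'K fls set" where "V2 = {z. poly L2 z = 0}"

lemma V2_iff: "z \<in> V2 \<longleftrightarrow> (\<Sum>i\<le>2 * m. \<iota> (lc i) * z ^ (q ^ i)) = 0"
  by (simp add: V2_def L2_def poly_additive_poly)

lemma degree_L2: "degree L2 = q ^ (2 * m)"
  unfolding L2_def by (rule degree_additive_poly) (simp_all add: q_ge lc_top)

lemma finite_V2: "finite V2" and card_V2_le: "card V2 \<le> q ^ (2 * m)"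
proof -
  have "L2 \<noteq> 0" using degree_L2 q_pos by (metis degree_0 less_irrefl zero_less_power)
  then show "finite V2" "card V2 \<le> q ^ (2 * m)"
    using poly_roots_finite card_poly_roots_bound[of L2] unfolding V2_def degree_L2 by auto
qed

lemma W_lift: "W \<subseteq> (\<lambda>y. fls_nth y 0) ` V2"
proof
  fix w assume "w \<in> W"
  then have "(\<Sum>i\<le>2 * m. fps_nth (fps_of_poly (map_poly \<epsilon> (lc i))) 0 * w ^ (q ^ i)) = 0"
    by (simp add: W_def lin_def deg coeff_lc_0)
  moreover have "fps_of_poly (map_poly \<epsilon> (lc 0)) = 1" by (simp add: lc_0)
  ultimately obtain Y where Y: "fps_nth Y 0 = w" "(\<Sum>i\<le>2 * m. fps_of_poly (map_poly \<epsilon> (lc i)) * Y ^ (q ^ i)) = 0"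
    using hensel_additive[OF char q_eq s_pos, where a = "\<lambda>i. fps_of_poly (map_poly \<epsilon> (lc i))" and r = "2 * m" and w = w] by blast
  have "(\<Sum>i\<le>2 * m. \<iota> (lc i) * fps_to_fls Y ^ (q ^ i)) = fps_to_fls (\<Sum>i\<le>2 * m. fps_of_poly (map_poly \<epsilon> (lc i)) * Y ^ (q ^ i))"
    by (simp add: \<iota>_def fps_to_fls_sum fls_times_fps_to_fls fps_to_fls_power)
  then have "fps_to_fls Y \<in> V2" using Y(2) by (simp add: V2_iff)
  then show "w \<in> (\<lambda>y. fls_nth y 0) ` V2" using Y(1) by (intro image_eqI[of _ _ "fps_to_fls Y"]) auto
qed

text \<open>The lifts of the elements of \<open>W\<close> have distinct constant terms, so they
  already reach the bound given by the degree. Thus \<open>L2\<close> splits with distinct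
  roots.\<close>

lemma card_V2: "card V2 = q ^ (2 * m)"
proof (rule antisym[OF card_V2_le])
  have "card W \<le> card ((\<lambda>y. fls_nth y 0) ` V2)" using W_lift finite_V2 by (intro card_mono) auto
  also have "\<dots> \<le> card V2" using finite_V2 by (rule card_image_le)
  finally show "q ^ (2 * m) \<le> card V2" by (simp add: card_W)
qed

lemma ring_graph_base: "ring_graph {(\<pi> P, \<iota> P) | P. True}" (is "ring_graph ?R")
proof
  have "(\<pi> 1, \<iota> 1) \<in> ?R" by blast
  then show "(1, 1) \<in> ?R" by simp
  fix x y x' y' assume "(x, y) \<in> ?R" "(x', y') \<in> ?R"
  then obtain P P' where P: "x = \<pi> P" "y = \<iota> P" "x' = \<pi> P'" "y' = \<iota> P'" by blast
  have "(\<pi> (P - P'), \<iota> (P - P')) \<in> ?R" "(\<pi> (P * P'), \<iota> (P * P')) \<in> ?R" by blast+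
  then show "(x - x', y - y') \<in> ?R" "(x * x', y * y') \<in> ?R"
    by (simp_all add: P \<pi>.hom_minus \<iota>.hom_minus \<pi>.hom_mult \<iota>.hom_mult)
qed (auto simp: \<pi>_eq_0_iff \<iota>_eq_0_iff)

text \<open>Start from the graph of \<open>\<pi> P \<mapsto> \<iota> P\<close>, pass to fractions
  and adjoin the roots of \<open>L\<close>, which is possible because \<open>L2\<close> splits. The
  domain of the resulting graph is a subfield containing \<open>E\<close>.\<close>

lemma ex_embedding: "\<exists>h. subfield_hom E h \<and> (\<forall>P. h (\<pi> P) = \<iota> P)"
proof -
  define R where "R = {(\<pi> P, \<iota> P) | P. True}"
  interpret R: ring_graph R unfolding R_def by (rule ring_graph_base)
  define S where "S = {(x / x', y / y') | x y x' y'. (x, y) \<in> R \<and> (x', y') \<in> R \<and> x' \<noteq> 0}"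
  interpret S: field_graph S unfolding S_def by (rule R.fractions)
  have RS: "(\<pi> P, \<iota> P) \<in> S" for P
  proof -
    have "(\<pi> P / 1, \<iota> P / 1) \<in> S"
      unfolding S_def using R.one one_neq_zero R_def by blast
    then show ?thesis by simp
  qed
  let ?L = "additive_poly q (2 * m) (\<lambda>i. \<pi> (lc i))"
  have "(?L, L2) \<in> S.polys"
    unfolding L2_def by (rule S.polysI) (auto simp: coeff_additive_poly intro!: S.sum S.zero RS)
  moreover have "?L \<noteq> 0"
  proof -
    have "degree ?L = q ^ (2 * m)" by (rule degree_additive_poly) (simp_all add: q_ge lc_top)
    then show ?thesis using q_pos by (metis degree_0 less_irrefl zero_less_power)
  qed
  moreover have "card {z. poly L2 z = 0} = degree L2" using card_V2 degree_L2 by (simp add: V2_def)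
  ultimately obtain T where T: "field_graph T" "S \<subseteq> T" "V \<subseteq> fst ` T"
    using S.adjoin_roots[of ?L L2] unfolding V_eq by blast
  interpret T: field_graph T by fact
  have "is_subfield (fst ` T)"
    unfolding is_subfield_def
  proof (intro conjI ballI)
    show "0 \<in> fst ` T" "1 \<in> fst ` T" using T.zero T.one by force+
    fix x assume "x \<in> fst ` T"
    then obtain y where xy: "(x, y) \<in> T" by auto
    show "inverse x \<in> fst ` T" using T.inverse[OF xy] by force
    fix x' assume "x' \<in> fst ` T"
    then obtain y' where xy': "(x', y') \<in> T" by auto
    show "x + x' \<in> fst ` T" "x - x' \<in> fst ` T" "x * x' \<in> fst ` T"
      using T.add[OF xy xy'] T.diff[OF xy xy'] T.mult[OF xy xy'] by force+
  qed
  moreover have "range e \<subseteq> fst ` T"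
  proof
    fix x assume "x \<in> range e"
    then obtain P Q where "x = \<pi> P / \<pi> Q" using e_quotient by blast
    moreover have "(\<pi> P / \<pi> Q, \<iota> P / \<iota> Q) \<in> T" using RS T(2) by (intro T.divide) auto
    ultimately show "x \<in> fst ` T" by force
  qed
  ultimately have ET: "E \<subseteq> fst ` T" using T(3) by (intro splitE_least)
  \<comment> \<open>The choice is forced on the domain of \<open>T\<close>, since the graph is
    single-valued by \<open>T.eq_iff\<close>.\<close>
  define h where "h = (\<lambda>x. SOME y. (x, y) \<in> T)"
  have hT: "(x, h x) \<in> T" if "(x, y) \<in> T" for x y
    unfolding h_def using that by (rule someI)
  have h_eq: "h x = y" if "(x, y) \<in> T" for x y
    using T.eq_iff[OF hT[OF that] that] by simp
  have hE: "(x, h x) \<in> T" if "x \<in> E" for x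
    using ET that hT by fastforce
  have "subfield_hom E h"
    using is_subfield_splitE
    by (intro subfield_hom.intro) (auto intro!: h_eq T.add T.mult T.one hE)
  moreover have "h (\<pi> P) = \<iota> P" for P using RS T(2) by (intro h_eq) auto
  ultimately show ?thesis by blast
qed

end

section \<open>The Frobenius element\<close>

locale frobenius_lift = frobenius_setup M q s m e + h: subfield_hom "splitE e q m M" h
  for M :: "'a::{field,finite} poly" and q s m :: nat and e :: "'a poly fract \<Rightarrow> 'b::field"
    and h :: "'b \<Rightarrow> 'b fls" +
  assumes h_\<pi>: "h (\<pi> P) = \<iota> P"
begin

text \<open>\<open>h\<close> maps roots to roots injectively, and both root sets have
  \<open>q ^ (2 * m)\<close> elements.\<close>

lemma h_image_V: "h ` V = V2"
proof (rule card_subset_eq[OF finite_V2])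
  show "h ` V \<subseteq> V2"
  proof
    fix y assume "y \<in> h ` V"
    then obtain v where v: "v \<in> V" "y = h v" by blast
    then have vE: "v \<in> E" using V_sub_E by blast
    have "(\<Sum>i\<le>2 * m. \<iota> (lc i) * y ^ (q ^ i)) = h (\<Sum>i\<le>2 * m. \<pi> (lc i) * v ^ (q ^ i))"
      using vE by (subst h.hom_sum) (simp_all add: v(2) h.hom_mult h.hom_power h_\<pi> h.closed h.closed_power \<pi>_in_E)
    also have "\<dots> = 0" using v V_iff h.hom_zero by simp
    finally show "y \<in> V2" by (simp add: V2_iff)
  qed
  show "card (h ` V) = card V2"
    using card_image[OF inj_on_subset[OF h.inj_on_E V_sub_E]] card_V card_V2 by simp
qed

section \<open>Coefficientwise Frobenius on the image of the splitting field\<close>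

abbreviation \<phi> :: "'b fls \<Rightarrow> 'b fls" where "\<phi> \<equiv> fls_frobenius q"

lemma \<phi>_nth: "fls_nth (\<phi> f) n = fls_nth f n ^ q"
  by (rule fls_frobenius_nth[OF q_pos])

lemmas \<phi>_add = fls_frobenius_add[OF char q_eq]
  and \<phi>_mult = fls_frobenius_mult[OF char q_eq]
  and \<phi>_inject = fls_frobenius_inject[OF inj_power_char_two[OF char q_eq] q_pos]

lemma \<phi>_\<iota>: "\<phi> (\<iota> P) = \<iota> P"
  by (rule fls_eqI) (simp add: \<phi>_nth \<iota>_def eps_power_q q_pos)

lemma \<phi>_1: "\<phi> 1 = 1"
  using \<phi>_\<iota>[of 1] by simp

sublocale \<phi>h: subfield_hom "splitE e q m M" "\<lambda>x. \<phi> (h x)"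
  by unfold_locales (simp_all add: is_subfield_splitE h.hom_add h.hom_mult h.hom_one \<phi>_add \<phi>_mult \<phi>_1)

lemma \<phi>_inverse: "x \<in> E \<Longrightarrow> \<phi> (inverse (h x)) = inverse (\<phi> (h x))"
  using \<phi>h.hom_inverse[of x] by (simp add: h.hom_inverse)

lemma \<phi>_diff: "x \<in> E \<Longrightarrow> y \<in> E \<Longrightarrow> \<phi> (h x - h y) = \<phi> (h x) - \<phi> (h y)"
  using \<phi>h.hom_diff[of x y] by (simp add: h.hom_diff)

lemma \<phi>_h_e: "\<phi> (h (e c)) = h (e c)"
proof -
  obtain P Q where "e c = \<pi> P * inverse (\<pi> Q)" using e_quotient[of c] by (auto simp: divide_inverse)
  then show ?thesis
    using \<phi>_inverse[OF \<pi>_in_E, of Q]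
    by (simp add: h.hom_mult h.hom_inverse \<phi>_mult \<pi>_in_E h.closed h_\<pi> \<phi>_\<iota>)
qed

lemma \<phi>_image_V2: "\<phi> ` V2 = V2"
proof (rule endo_inj_surj[OF finite_V2])
  show "inj_on \<phi> V2" by (rule inj_onI) (rule \<phi>_inject)
  show "\<phi> ` V2 \<subseteq> V2"
  proof
    fix y assume "y \<in> \<phi> ` V2"
    then obtain v where "v \<in> V" "y = \<phi> (h v)" unfolding h_image_V[symmetric] by blast
    then have v: "v \<in> V" "y = \<phi> (h v)" "v \<in> E" using V_sub_E by auto
    have "(\<Sum>i\<le>2 * m. \<iota> (lc i) * y ^ (q ^ i)) = \<phi> (h (\<Sum>i\<le>2 * m. \<pi> (lc i) * v ^ (q ^ i)))"
      using v(3) by (subst \<phi>h.hom_sum)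
        (simp_all add: v(2) \<phi>h.hom_mult \<phi>h.hom_power h_\<pi> \<phi>_\<iota> h.closed h.closed_power \<pi>_in_E)
    also have "\<dots> = 0" using v V_iff \<phi>h.hom_zero by simp
    finally show "y \<in> V2" by (simp add: V2_iff)
  qed
qed

lemma \<phi>_h_in: "x \<in> E \<Longrightarrow> \<phi> (h x) \<in> h ` E"
proof -
  let ?G = "{x \<in> E. \<phi> (h x) \<in> h ` E}"
  have "is_subfield ?G"
    unfolding is_subfield_def
  proof (intro conjI ballI)
    show "0 \<in> ?G" "1 \<in> ?G" using \<phi>h.hom_zero \<phi>h.hom_one h.hom_zero h.hom_one h.closed(1,2) by force+
    fix x assume "x \<in> ?G"
    then obtain x' where x: "x \<in> E" "x' \<in> E" "\<phi> (h x) = h x'" by auto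
    have "\<phi> (h (inverse x)) = h (inverse x')" using x by (simp add: \<phi>_inverse h.hom_inverse)
    then show "inverse x \<in> ?G" using x h.closed by auto
    fix y assume "y \<in> ?G"
    then obtain y' where y: "y \<in> E" "y' \<in> E" "\<phi> (h y) = h y'" by auto
    have "\<phi> (h (x + y)) = h (x' + y')" "\<phi> (h (x - y)) = h (x' - y')" "\<phi> (h (x * y)) = h (x' * y')"
      using x y by (simp_all add: \<phi>_add h.hom_add \<phi>_diff h.hom_diff \<phi>_mult h.hom_mult)
    then show "x + y \<in> ?G" "x - y \<in> ?G" "x * y \<in> ?G" using x y h.closed by auto
  qed
  moreover have "range e \<subseteq> ?G" using \<phi>_h_e range_e_sub_E by auto
  moreover have "\<phi> (h v) \<in> h ` E" if "v \<in> V" for v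
  proof -
    have "\<phi> (h v) \<in> \<phi> ` h ` V" using that by blast
    then have "\<phi> (h v) \<in> h ` V" by (simp only: h_image_V \<phi>_image_V2)
    then show ?thesis using V_sub_E by blast
  qed
  then have "V \<subseteq> ?G" using V_sub_E by auto
  ultimately show "x \<in> E \<Longrightarrow> \<phi> (h x) \<in> h ` E" using splitE_least[of ?G] by blast
qed

text \<open>The converse inclusion, by the same minimality argument; it yields the surjectivity of
  \<open>\<sigma>\<close>.\<close>

lemma h_in_\<phi>_h: "x \<in> E \<Longrightarrow> h x \<in> (\<lambda>x. \<phi> (h x)) ` E"
proof -
  let ?G = "{x \<in> E. h x \<in> (\<lambda>x. \<phi> (h x)) ` E}"
  have "is_subfield ?G"
    unfolding is_subfield_def
  proof (intro conjI ballI)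
    show "0 \<in> ?G" "1 \<in> ?G" using \<phi>h.hom_zero \<phi>h.hom_one h.hom_zero h.hom_one h.closed(1,2) by force+
    fix x assume "x \<in> ?G"
    then obtain x' where x: "x \<in> E" "x' \<in> E" "h x = \<phi> (h x')" by auto
    have "h (inverse x) = \<phi> (h (inverse x'))" using x by (simp add: \<phi>_inverse h.hom_inverse)
    then show "inverse x \<in> ?G" using x h.closed by auto
    fix y assume "y \<in> ?G"
    then obtain y' where y: "y \<in> E" "y' \<in> E" "h y = \<phi> (h y')" by auto
    have "h (x + y) = \<phi> (h (x' + y'))" "h (x - y) = \<phi> (h (x' - y'))" "h (x * y) = \<phi> (h (x' * y'))"
      using x y by (simp_all add: \<phi>_add h.hom_add \<phi>_diff h.hom_diff \<phi>_mult h.hom_mult)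
    then show "x + y \<in> ?G" "x - y \<in> ?G" "x * y \<in> ?G" using x y h.closed by auto
  qed
  moreover have "e c \<in> ?G" for c
    using range_e_sub_E by (auto intro!: image_eqI[of _ _ "e c"] simp: \<phi>_h_e)
  then have "range e \<subseteq> ?G" by blast
  moreover have "h v \<in> (\<lambda>x. \<phi> (h x)) ` E" if "v \<in> V" for v
  proof -
    have "h v \<in> h ` V" using that by blast
    then have "h v \<in> \<phi> ` h ` V" by (simp only: h_image_V \<phi>_image_V2)
    then show ?thesis using V_sub_E by auto
  qed
  then have "V \<subseteq> ?G" using V_sub_E by auto
  ultimately show "x \<in> E \<Longrightarrow> h x \<in> (\<lambda>x. \<phi> (h x)) ` E" using splitE_least[of ?G] by blast
qed

text \<open>The pullback of \<open>\<phi>\<close> along \<open>h\<close>; outside \<open>E\<close>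
  it is the identity because \<open>galG\<close> demands this of its members.\<close>

definition \<sigma> :: "'b \<Rightarrow> 'b" where
  "\<sigma> x = (if x \<in> E then inv_into E h (\<phi> (h x)) else x)"

lemma \<sigma>_in_E: "x \<in> E \<Longrightarrow> \<sigma> x \<in> E"
  unfolding \<sigma>_def using \<phi>_h_in by (simp add: inv_into_into)

lemma h_\<sigma>: "x \<in> E \<Longrightarrow> h (\<sigma> x) = \<phi> (h x)"
  unfolding \<sigma>_def using \<phi>_h_in by (simp add: f_inv_into_f)

lemma h_inject: "x \<in> E \<Longrightarrow> y \<in> E \<Longrightarrow> h x = h y \<Longrightarrow> x = y"
  using h.inj_on_E by (auto dest: inj_onD)

lemma e_in_E: "e c \<in> E"
  using range_e_sub_E by auto

lemma \<sigma>_e: "\<sigma> (e c) = e c"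
  by (rule h_inject) (simp_all add: \<sigma>_in_E e_in_E h_\<sigma> \<phi>_h_e)

sublocale \<sigma>: subfield_hom "splitE e q m M" \<sigma>
proof
  show "is_subfield E" by (rule is_subfield_splitE)
  show "\<sigma> 1 = 1" using \<sigma>_e[of 1] by simp
  fix x y assume "x \<in> E" "y \<in> E"
  then show "\<sigma> (x + y) = \<sigma> x + \<sigma> y" "\<sigma> (x * y) = \<sigma> x * \<sigma> y"
    by (auto intro!: h_inject simp: \<sigma>_in_E h.closed h_\<sigma> h.hom_add h.hom_mult \<phi>_add \<phi>_mult)
qed

lemma \<sigma>_bij: "bij_betw \<sigma> E E"
  unfolding bij_betw_def
proof (intro conjI \<sigma>.inj_on_E equalityI subsetI)
  fix x assume "x \<in> E"
  then obtain y where "y \<in> E" "h x = \<phi> (h y)" using h_in_\<phi>_h by auto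
  then have "x = \<sigma> y" using \<open>x \<in> E\<close> by (intro h_inject) (simp_all add: \<sigma>_in_E h_\<sigma>)
  then show "x \<in> \<sigma> ` E" using \<open>y \<in> E\<close> by blast
qed (auto simp: \<sigma>_in_E)

lemma \<sigma>_galG: "\<sigma> \<in> galG e q m M"
  unfolding galG_def Let_def using \<sigma>_bij
  by (auto simp: \<sigma>.hom_add \<sigma>.hom_mult \<sigma>_e) (simp add: \<sigma>_def)

lemma id_galG: "id \<in> galG e q m M"
  unfolding galG_def Let_def by auto

section \<open>Integral elements and the prime above \<open>t\<close>\<close>

abbreviation R where "R \<equiv> intR e q m M"

lemma R_iff: "z \<in> R \<longleftrightarrow> z \<in> E \<and> integral_over \<pi> z"
  by (simp add: intR_def integral_over_def e_comp)

lemma R_ring: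
  assumes "x \<in> R" "y \<in> R"
  shows "x + y \<in> R" "x * y \<in> R" "- x \<in> R" "x - y \<in> R"
proof -
  note I = integral_over_ring[OF \<pi>_hom]
  show "x + y \<in> R" "x * y \<in> R" "- x \<in> R"
    using assms I by (auto simp: R_iff h.closed h.closed_uminus)
  have "- y \<in> R" using assms I by (auto simp: R_iff h.closed_uminus)
  then have "x + - y \<in> R" using assms I by (auto simp: R_iff h.closed h.closed_uminus simp del: add_uminus_conv_diff)
  then show "x - y \<in> R" by simp
qed

lemma \<pi>_in_R: "\<pi> P \<in> R"
  by (simp add: R_iff \<pi>_in_E integral_over_hom[OF \<pi>_hom])

lemma R_power: "x \<in> R \<Longrightarrow> x ^ n \<in> R"
  by (induction n) (use \<pi>_in_R[of 1] R_ring in auto)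

lemma R_sub_E: "x \<in> R \<Longrightarrow> x \<in> E"
  by (simp add: R_iff)

text \<open>Applying \<open>h\<close> to a monic equation over F_q[t] gives one whose coefficients
  are power series, so \<open>h z\<close> has no pole. This makes the constant term multiplicative
  on \<open>R\<close>.\<close>

lemma R_subdegree: "z \<in> R \<Longrightarrow> fls_subdegree (h z) \<ge> 0"
proof -
  assume "z \<in> R"
  then obtain p where z: "z \<in> E" and p: "lead_coeff p = 1" "poly (map_poly \<pi> p) z = 0"
    by (auto simp: R_iff integral_over_def)
  have "poly (map_poly \<iota> p) (h z) = h (poly (map_poly \<pi> p) z)"
    using h.hom_poly[where g = \<pi> and z = z and p = p, OF \<pi>_in_E \<pi>.hom_zero z] by (simp add: h_\<pi>)
  then have "poly (map_poly \<iota> p) (h z) = 0" using p h.hom_zero by simp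
  moreover have "degree (map_poly \<iota> p) = degree p" using p by (intro degree_map_poly) (auto simp: \<iota>_eq_0_iff)
  then have "lead_coeff (map_poly \<iota> p) = 1" using p by (simp add: coeff_map_poly)
  ultimately show ?thesis
    using fls_integral_over_fps[of "map_poly \<iota> p" "h z"] by (simp add: coeff_map_poly \<iota>_subdegree)
qed

text \<open>On \<open>R\<close> this is reduction modulo the prime \<open>J\<close>, with values in
  \<open>K\<close>.\<close>

definition \<psi> :: "'b \<Rightarrow> 'b" where "\<psi> z = fls_nth (h z) 0"

lemma \<psi>_add: "x \<in> E \<Longrightarrow> y \<in> E \<Longrightarrow> \<psi> (x + y) = \<psi> x + \<psi> y"
  by (simp add: \<psi>_def h.hom_add)

lemma \<psi>_diff: "x \<in> E \<Longrightarrow> y \<in> E \<Longrightarrow> \<psi> (x - y) = \<psi> x - \<psi> y"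
  by (simp add: \<psi>_def h.hom_diff)

lemma \<psi>_mult: "x \<in> R \<Longrightarrow> y \<in> R \<Longrightarrow> \<psi> (x * y) = \<psi> x * \<psi> y"
  by (simp add: \<psi>_def h.hom_mult R_sub_E fls_nth_mult_0 R_subdegree)

lemma \<psi>_\<pi>: "\<psi> (\<pi> P) = \<epsilon> (coeff P 0)"
  by (simp add: \<psi>_def h_\<pi> \<iota>_nth_0)

lemma \<psi>_one: "\<psi> 1 = 1"
  using \<psi>_\<pi>[of 1] by simp

lemma \<psi>_zero: "\<psi> 0 = 0"
  using \<psi>_\<pi>[of 0] by simp

lemma \<psi>_uminus: "x \<in> E \<Longrightarrow> \<psi> (- x) = - \<psi> x"
  by (simp add: \<psi>_def h.hom_uminus)

lemma \<psi>_power: "x \<in> R \<Longrightarrow> \<psi> (x ^ n) = \<psi> x ^ n"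
  by (induction n) (simp_all add: \<psi>_one \<psi>_mult R_power)

lemma \<psi>_\<sigma>: "x \<in> E \<Longrightarrow> \<psi> (\<sigma> x) = \<psi> x ^ q"
  by (simp add: \<psi>_def h_\<sigma> \<phi>_nth)

text \<open>\<open>\<sigma>\<close> fixes the coefficients \<open>\<pi> P\<close>, so
  \<open>x\<close> and \<open>\<sigma> x\<close> satisfy the same monic equations.\<close>

lemma \<sigma>_R_iff: "x \<in> E \<Longrightarrow> \<sigma> x \<in> R \<longleftrightarrow> x \<in> R"
proof -
  assume x: "x \<in> E"
  have "poly (map_poly \<pi> p) (\<sigma> x) = \<sigma> (poly (map_poly \<pi> p) x)" for p
    using \<sigma>.hom_poly[where g = \<pi> and z = x and p = p, OF \<pi>_in_E \<pi>.hom_zero x]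
    by (simp add: \<sigma>_e[of "poly_fr _", folded \<pi>_def])
  then have "poly (map_poly \<pi> p) (\<sigma> x) = 0 \<longleftrightarrow> poly (map_poly \<pi> p) x = 0" for p
    using \<sigma>.hom_eq_0_iff[OF \<sigma>.closed_poly[where g = \<pi> and z = x and p = p, OF \<pi>_in_E \<pi>.hom_zero x]] by simp
  then show ?thesis by (simp add: R_iff integral_over_def x \<sigma>_in_E)
qed

definition J :: "'b set" where "J = {z \<in> R. \<psi> z = 0}"

text \<open>\<open>J\<close> is the kernel on \<open>R\<close> of the ring homomorphism
  \<open>\<psi>\<close> into a field, hence prime. On polynomials \<open>\<psi>\<close> is
  evaluation at \<open>0\<close>, so \<open>J\<close> lies above the ideal of
  \<open>t\<close>.\<close>

lemma prime_above_J: "prime_above e R 0 J"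
  unfolding prime_above_def
proof (intro conjI ballI allI impI)
  show "J \<subseteq> R" by (auto simp: J_def)
  show "0 \<in> J" using \<pi>_in_R[of 0] \<psi>_zero by (simp add: J_def)
  show "1 \<notin> J" using \<psi>_one by (simp add: J_def)
  fix x assume x: "x \<in> J"
  show "- x \<in> J" using x R_ring(3)[of x x] by (simp add: J_def R_sub_E \<psi>_uminus)
  show "x + y \<in> J" if "y \<in> J" for y using x that R_ring by (simp add: J_def R_sub_E \<psi>_add)
  show "r * x \<in> J" if "r \<in> R" for r using x that R_ring by (simp add: J_def \<psi>_mult)
next
  fix a b assume "a \<in> R" "b \<in> R" "a * b \<in> J"
  then show "a \<in> J \<or> b \<in> J" by (auto simp: J_def \<psi>_mult)
next
  fix P
  have "e (poly_fr P) \<in> J \<longleftrightarrow> poly P 0 = 0"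
    using \<pi>_in_R[of P] \<psi>_\<pi>[of P] by (simp add: J_def \<pi>_def poly_0_coeff_0)
  then show "e (poly_fr P) \<in> J \<longleftrightarrow> [:- 0, 1:] dvd P" by (simp only: poly_eq_0_iff_dvd)
qed

text \<open>The congruence modulo \<open>J\<close> is the identity
  \<open>\<psi> (\<sigma> z) = \<psi> z ^ q\<close>, which also shows that \<open>\<sigma>\<close>
  preserves \<open>J\<close> in both directions.\<close>

lemma frobenius_at_J: "frobenius_at e q m M J \<sigma>"
  unfolding frobenius_at_def
proof (intro conjI ballI \<sigma>_galG equalityI subsetI)
  fix z assume "z \<in> \<sigma> ` J"
  then show "z \<in> J" using q_pos by (auto simp: J_def \<sigma>_R_iff R_sub_E \<psi>_\<sigma>)
next
  fix z assume z: "z \<in> J"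
  then have "z \<in> E" by (simp add: J_def R_sub_E)
  then obtain y where y: "y \<in> E" "z = \<sigma> y" using \<sigma>_bij by (auto simp: bij_betw_def)
  then have "y \<in> J" using z q_pos by (simp add: J_def \<sigma>_R_iff \<psi>_\<sigma>)
  then show "z \<in> \<sigma> ` J" using y by blast
next
  fix z assume z: "z \<in> R"
  then have "z ^ q \<in> R" "\<sigma> z \<in> R" using R_power \<sigma>_R_iff R_sub_E by auto
  then show "\<sigma> z - z ^ q \<in> J"
    using z by (simp add: J_def R_ring \<psi>_diff R_sub_E \<psi>_\<sigma> \<psi>_power)
qed

end

section \<open>The transvection\<close>

context frobenius_setup
begin

lemma V_iff_lin:
  "v \<in> V \<longleftrightarrow> lin M v + e tvar ^ q * v ^ (q ^ (m + 1)) + e tvar * v ^ (q ^ (m - 1)) = 0"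
proof -
  have t: "e tvar = \<pi> [:0, 1:]" by (simp add: \<pi>_def tvar_def poly_fr_def)
  have tq: "e tvar ^ q = \<pi> (monom 1 q)"
    unfolding t \<pi>.hom_power[symmetric] by (simp add: monom_altdef)
  have "\<pi> (lc i) * v ^ (q ^ i) = \<epsilon> (coeff M i) * v ^ (q ^ i)
      + (if i = m + 1 then e tvar ^ q * v ^ (q ^ i) else 0) + (if i = m - 1 then e tvar * v ^ (q ^ i) else 0)" for i
    unfolding tq unfolding t by (simp add: lc_def \<pi>.hom_add \<epsilon>_eq distrib_right)
  then have "(\<Sum>i\<le>2 * m. \<pi> (lc i) * v ^ (q ^ i)) = lin M v + e tvar ^ q * v ^ (q ^ (m + 1)) + e tvar * v ^ (q ^ (m - 1))"
    using m_ge by (simp add: sum.distrib lin_def deg)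
  then show ?thesis by (simp add: V_iff)
qed

lemma V_add: "v \<in> V \<Longrightarrow> w \<in> V \<Longrightarrow> v + w \<in> V"
  by (simp add: V_iff power_qi_add distrib_left sum.distrib)

lemma V_diff: "v \<in> V \<Longrightarrow> w \<in> V \<Longrightarrow> v - w \<in> V"
  by (simp add: diff_eq_add V_add)

lemma V_scale: "v \<in> V \<Longrightarrow> \<epsilon> c * v \<in> V"
  by (simp add: V_iff power_mult_distrib eps_power_qi mult.left_commute[of _ "\<epsilon> c"] flip: sum_distrib_left)

lemma poly_map_linearized: "poly (map_poly \<epsilon> (linearized q M)) v = lin M v"
proof -
  interpret mp: map_poly_comm_ring_hom \<epsilon> ..
  show ?thesis
    by (simp add: linearized_def mp.hom_sum map_poly_monom poly_sum poly_monom lin_def)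
qed

lemma Qform_eq:
  "Qform e q m M v = e tvar * v ^ (q ^ m + q ^ (m - 1)) + poly (map_poly \<epsilon> (fpoly q m M)) v"
  by (simp add: Qform_def e_comp)

lemma Qform_in_range:
  assumes f: "fpoly q m M ^ q - fpoly q m M = monom 1 (q ^ m) * linearized q M" and v: "v \<in> V"
  shows "Qform e q m M v \<in> range \<epsilon>"
proof -
  interpret mp: map_poly_comm_ring_hom \<epsilon> ..
  define F where "F = poly (map_poly \<epsilon> (fpoly q m M)) v"
  define a where "a = e tvar"
  have "poly (map_poly \<epsilon> (fpoly q m M ^ q - fpoly q m M)) v = v ^ (q ^ m) * lin M v"
    unfolding f by (simp add: mp.hom_mult map_poly_monom poly_monom poly_map_linearized)
  then have F: "F ^ q = F + v ^ (q ^ m) * lin M v"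
    by (simp add: F_def mp.hom_minus mp.hom_power algebra_simps)
  have "(a * v ^ (q ^ m + q ^ (m - 1))) ^ q = a ^ q * v ^ ((q ^ m + q ^ (m - 1)) * q)"
    by (simp only: power_mult_distrib power_mult)
  also have "(q ^ m + q ^ (m - 1)) * q = q ^ m + q ^ (m + 1)"
    using m_ge by (simp add: distrib_right add.commute flip: power_Suc2)
  finally have "(a * v ^ (q ^ m + q ^ (m - 1))) ^ q = a ^ q * (v ^ (q ^ m) * v ^ (q ^ (m + 1)))"
    by (simp only: power_add[of v])
  then have "Qform e q m M v ^ q = a ^ q * (v ^ (q ^ m) * v ^ (q ^ (m + 1))) + (F + v ^ (q ^ m) * lin M v)"
    unfolding Qform_eq by (simp only: power_q_add F flip: a_def F_def)
  also have "\<dots> = F + v ^ (q ^ m) * (lin M v + a ^ q * v ^ (q ^ (m + 1)))" by (simp add: algebra_simps)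
  \<comment> \<open>This is the equation \<open>L(v) = 0\<close>; in characteristic two the last
    summand changes sides without a sign.\<close>
  also have "lin M v + a ^ q * v ^ (q ^ (m + 1)) = a * v ^ (q ^ (m - 1))"
    using v unfolding V_iff_lin a_def[symmetric]
    by (simp add: uminus_char_two[OF char] add_eq_0_iff2)
  also have "F + v ^ (q ^ m) * (a * v ^ (q ^ (m - 1))) = Qform e q m M v"
    by (simp add: Qform_eq F_def a_def power_add mult_ac)
  finally show ?thesis by (simp only: fixed_iff)
qed

end

section \<open>Reduction of \<open>V\<close> to constant terms and the transvection property\<close>

context frobenius_lift
begin

text \<open>\<open>L\<close> is monic with coefficients \<open>lc i\<close> in F_q[t].\<close>

lemma V_sub_R: "V \<subseteq> R"
proof
  fix v assume v: "v \<in> V"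
  define p where "p = additive_poly q (2 * m) lc"
  have "degree p = q ^ (2 * m)" unfolding p_def by (rule degree_additive_poly) (simp_all add: q_ge lc_top)
  then have "lead_coeff p = 1" using coeff_additive_poly_top[OF q_ge, of "2 * m" lc] by (simp add: p_def lc_top)
  moreover have "map_poly \<pi> p = additive_poly q (2 * m) (\<lambda>i. \<pi> (lc i))"
    by (rule poly_eqI)
      (simp add: p_def coeff_map_poly coeff_additive_poly \<pi>.hom_sum if_distrib[of \<pi>] cong: if_cong)
  then have "poly (map_poly \<pi> p) v = 0" using v by (simp add: V_eq)
  ultimately show "v \<in> R" using v V_sub_E by (auto simp: R_iff integral_over_def)
qed

lemma \<psi>_scale: "v \<in> V \<Longrightarrow> \<psi> (\<epsilon> c * v) = \<epsilon> c * \<psi> v"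
  unfolding \<epsilon>_eq using V_sub_R by (subst \<psi>_mult) (auto simp: \<pi>_in_R \<psi>_\<pi> \<epsilon>_eq)

text \<open>Every element of \<open>W\<close> lifts to \<open>V\<close>, and both sets have the same
  finite cardinality, so reduction is a bijection between them.\<close>

lemma \<psi>_image_V: "\<psi> ` V = W" and \<psi>_inj_V: "inj_on \<psi> V"
proof -
  have "\<psi> ` V = (\<lambda>y. fls_nth y 0) ` V2"
    unfolding h_image_V[symmetric] image_image \<psi>_def ..
  then have sub: "W \<subseteq> \<psi> ` V" using W_lift by simp
  have le: "card (\<psi> ` V) \<le> card W" using card_image_le[OF finite_V, of \<psi>] card_V card_W by simp
  show eq: "\<psi> ` V = W" using card_seteq[OF _ sub le] finite_V by auto
  show "inj_on \<psi> V" using finite_V by (rule eq_card_imp_inj_on) (simp add: eq card_V card_W)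
qed

lemma \<sigma>_V: "v \<in> V \<Longrightarrow> \<sigma> v \<in> V"
proof -
  assume v: "v \<in> V"
  then have vE: "v \<in> E" using V_sub_E by blast
  have "\<sigma> (\<pi> P) = \<pi> P" for P by (simp add: \<pi>_def \<sigma>_e)
  then have "(\<Sum>i\<le>2 * m. \<pi> (lc i) * \<sigma> v ^ (q ^ i)) = \<sigma> (\<Sum>i\<le>2 * m. \<pi> (lc i) * v ^ (q ^ i))"
    using vE by (subst \<sigma>.hom_sum) (simp_all add: \<sigma>.hom_mult \<sigma>.hom_power h.closed h.closed_power \<pi>_in_E)
  also have "\<dots> = 0" using v V_iff \<sigma>.hom_zero by simp
  finally show ?thesis by (simp add: V_iff)
qed

lemma \<sigma>_power_V: "v \<in> V \<Longrightarrow> (\<sigma> ^^ k) v \<in> V \<and> \<psi> ((\<sigma> ^^ k) v) = \<psi> v ^ (q ^ k)"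
proof (induction k)
  case (Suc k)
  then have IH: "(\<sigma> ^^ k) v \<in> V" "\<psi> ((\<sigma> ^^ k) v) = \<psi> v ^ (q ^ k)" by auto
  then have "\<psi> (\<sigma> ((\<sigma> ^^ k) v)) = \<psi> v ^ (q ^ Suc k)"
    using V_sub_E by (subst \<psi>_\<sigma>) (auto simp: mult.commute[of q] simp flip: power_mult)
  then show ?case using \<sigma>_V[OF IH(1)] by simp
qed simp

lemma \<sigma>_power_E: "x \<in> E \<Longrightarrow> (\<sigma> ^^ k) x \<in> E"
  by (induction k) (simp_all add: \<sigma>_in_E)

lemma \<sigma>_power_e: "(\<sigma> ^^ k) (e c) = e c"
  by (induction k) (simp_all add: \<sigma>_e)

lemma \<sigma>_power_hom: "subfield_hom E (\<sigma> ^^ k)"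
proof (induction k)
  case (Suc k)
  then interpret k: subfield_hom E "\<sigma> ^^ k" .
  show ?case
    by unfold_locales (simp_all add: is_subfield_splitE k.hom_add k.hom_mult k.hom_one
        \<sigma>.hom_add \<sigma>.hom_mult \<sigma>.hom_one \<sigma>_power_E)
qed (unfold_locales; simp add: is_subfield_splitE)

text \<open>Since \<open>\<psi>\<close> is injective on \<open>V\<close>, the statements about
  \<open>\<tau> v - v\<close> can be checked on constant terms, where \<open>\<tau>\<close> acts as
  the \<open>q ^ k\<close>-th power.\<close>

lemma orth_transvection_\<sigma>_power:
  assumes k: "{w ^ (q ^ k) - w | w. lin M w = 0} = range \<epsilon>"
    and Q: "\<And>v. v \<in> V \<Longrightarrow> Qform e q m M v \<in> range \<epsilon>"
  shows "orth_transvection e (Qform e q m M) V (\<sigma> ^^ k)"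
proof -
  define \<tau> where "\<tau> = \<sigma> ^^ k"
  interpret \<tau>: subfield_hom E \<tau> unfolding \<tau>_def by (rule \<sigma>_power_hom)
  have E: "v \<in> E" if "v \<in> V" for v using that V_sub_E by blast
  have \<tau>V: "\<tau> v \<in> V" and \<psi>\<tau>: "\<psi> (\<tau> v) = \<psi> v ^ (q ^ k)" if "v \<in> V" for v
    using \<sigma>_power_V[OF that, of k] by (auto simp: \<tau>_def)
  have \<tau>e: "\<tau> (e c) = e c" for c by (simp add: \<tau>_def \<sigma>_power_e)
  have inj: "v = w" if "v \<in> V" "w \<in> V" "\<psi> v = \<psi> w" for v w
    using \<psi>_inj_V that by (auto dest: inj_onD)
  have dV: "\<tau> v - v \<in> V" and \<psi>d: "\<psi> (\<tau> v - v) = \<psi> v ^ (q ^ k) - \<psi> v" if "v \<in> V" for v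
    using that by (simp_all add: V_diff \<tau>V \<psi>_diff E \<psi>\<tau>)
  have range1: "\<psi> (\<tau> v - v) \<in> range \<epsilon>" if "v \<in> V" for v
  proof -
    have "lin M (\<psi> v) = 0" using \<psi>_image_V that by (auto simp: W_def)
    then show ?thesis unfolding k[symmetric] \<psi>d[OF that] by blast
  qed
  have range2: "\<exists>v\<in>V. \<psi> (\<tau> v - v) = \<epsilon> c" for c
  proof -
    have "\<epsilon> c \<in> {w ^ (q ^ k) - w | w. lin M w = 0}" unfolding k by blast
    then obtain w where w: "w \<in> W" "\<epsilon> c = w ^ (q ^ k) - w" by (auto simp: W_def)
    then obtain v where "v \<in> V" "w = \<psi> v" using \<psi>_image_V by blast
    then show ?thesis using w \<psi>d by (intro bexI[of _ v]) auto
  qed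
  \<comment> \<open>Normalised so that \<open>w\<close> has constant term \<open>1\<close>: an
    element of \<open>V\<close> with constant term \<open>\<epsilon> c\<close> is then
    \<open>\<epsilon> c * w\<close>.\<close>
  obtain v\<^sub>0 where v0: "v\<^sub>0 \<in> V" "\<psi> (\<tau> v\<^sub>0 - v\<^sub>0) = 1" using range2[of 1] by auto
  define w where "w = \<tau> v\<^sub>0 - v\<^sub>0"
  have w: "w \<in> V" "\<psi> w = 1" using v0 dV by (auto simp: w_def)
  have "bij_betw \<tau> V V"
    unfolding bij_betw_def
    using endo_inj_surj[OF finite_V, of \<tau>] inj_on_subset[OF \<tau>.inj_on_E V_sub_E] \<tau>V by blast
  moreover have "\<tau> (v + w) = \<tau> v + \<tau> w" if "v \<in> V" "w \<in> V" for v w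
    using that by (simp add: \<tau>.hom_add E)
  moreover have "\<tau> (e (const_fr c) * v) = e (const_fr c) * \<tau> v" if "v \<in> V" for v c
    using that by (simp add: \<tau>.hom_mult E e_in_E \<tau>e)
  \<comment> \<open>\<open>\<tau>\<close> fixes the coefficients of \<open>Q\<close>, so
    \<open>Q (\<tau> v) = \<tau> (Q v)\<close>, and \<open>Q v\<close> lies in F_q, which
    \<open>\<tau>\<close> fixes.\<close>
  moreover have "Qform e q m M (\<tau> v) = Qform e q m M v" if "v \<in> V" for v
  proof -
    have \<tau>\<epsilon>: "\<tau> (\<epsilon> c) = \<epsilon> c" for c by (simp add: \<epsilon>_def \<tau>e)
    have "\<tau> (poly (map_poly \<epsilon> (fpoly q m M)) v) = poly (map_poly \<epsilon> (fpoly q m M)) (\<tau> v)"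
      using \<tau>.hom_poly[where g = \<epsilon> and z = v and p = "fpoly q m M", OF \<epsilon>_in_E hom_zero E[OF that]] by (simp add: \<tau>\<epsilon>)
    moreover have "poly (map_poly \<epsilon> (fpoly q m M)) v \<in> E"
      by (rule h.closed_poly[where g = \<epsilon>, OF \<epsilon>_in_E hom_zero E[OF that]])
    ultimately have "\<tau> (Qform e q m M v) = Qform e q m M (\<tau> v)"
      unfolding Qform_eq using E[OF that]
      by (simp add: \<tau>.hom_add \<tau>.hom_mult \<tau>.hom_power \<tau>e e_in_E h.closed h.closed_power)
    moreover obtain c where "Qform e q m M v = \<epsilon> c" using Q \<open>v \<in> V\<close> by blast
    ultimately show ?thesis using \<tau>\<epsilon> by simp
  qed
  \<comment> \<open>The constant term of \<open>\<tau> v - v\<close> lies in F_q, hence is fixed by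
    the \<open>q ^ k\<close>-th power.\<close>
  moreover have "\<tau> (\<tau> v - v) - (\<tau> v - v) = 0" if "v \<in> V" for v
  proof -
    obtain c where "\<psi> (\<tau> v - v) = \<epsilon> c" using range1[OF \<open>v \<in> V\<close>] by blast
    then have "\<psi> (\<tau> (\<tau> v - v)) = \<psi> (\<tau> v - v)" by (simp add: \<psi>\<tau> dV that eps_power_qi)
    then have "\<tau> (\<tau> v - v) = \<tau> v - v" by (rule inj[OF \<tau>V[OF dV[OF that]] dV[OF that]])
    then show ?thesis by simp
  qed
  moreover have "\<exists>v\<in>V. \<tau> v \<noteq> v" using v0 \<psi>_zero by (intro bexI[of _ v\<^sub>0]) auto
  moreover have "w \<noteq> 0" using w \<psi>_zero by auto
  moreover have "{\<tau> v - v | v. v \<in> V} = {e (const_fr c) * w | c. True}"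
  proof (intro equalityI subsetI)
    fix x assume "x \<in> {\<tau> v - v | v. v \<in> V}"
    then obtain v where v: "v \<in> V" "x = \<tau> v - v" by blast
    then obtain c where "\<psi> x = \<epsilon> c" using range1 by blast
    then have "\<psi> x = \<psi> (\<epsilon> c * w)" using w by (simp add: \<psi>_scale)
    then have "x = \<epsilon> c * w" using v w inj[of x "\<epsilon> c * w"] by (simp add: dV V_scale)
    then show "x \<in> {e (const_fr c) * w | c. True}" by (auto simp: \<epsilon>_def)
  next
    fix x assume "x \<in> {e (const_fr c) * w | c. True}"
    then obtain c where c: "x = \<epsilon> c * w" by (auto simp: \<epsilon>_def)
    obtain v where v: "v \<in> V" "\<psi> (\<tau> v - v) = \<epsilon> c" using range2 by blast
    then have "x = \<tau> v - v" using w inj[of x "\<tau> v - v"] by (simp add: c dV V_scale \<psi>_scale)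
    then show "x \<in> {\<tau> v - v | v. v \<in> V}" using v by blast
  qed
  ultimately show ?thesis
    unfolding orth_transvection_def \<tau>_def[symmetric] using w(1) by blast
qed

end

theorem theorem4p10:
  fixes M :: "'a::{field,finite} poly"
    and q m :: nat
    and e :: "'a poly fract \<Rightarrow> 'K::field"
  assumes q_card: "card (UNIV :: 'a set) = q"
    and q_pow2: "\<exists>k. q = 2 ^ k"
    and m_ge: "m \<ge> 2"
    and deg: "degree M = 2 * m"
    and selfrec: "self_reciprocal M"
    and const1: "coeff M 0 = 1"
    and mult2: "order 1 M = 2"
    and simple: "\<forall>z. poly (map_poly (e \<circ> const_fr) (M div [:-1, 1:] ^ 2)) z = 0 \<longrightarrow>
                   order z (map_poly (e \<circ> const_fr) (M div [:-1, 1:] ^ 2)) = 1"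
    and emb: "field_emb e"
    and algclosed: "alg_closed_type TYPE('K)"
  shows "\<exists>\<mu>::'a. \<exists>J \<sigma>.
           prime_above e (intR e q m M) \<mu> J \<and> frobenius_at e q m M J \<sigma> \<and>
           (\<exists>\<tau>\<in>galG e q m M. (\<exists>g\<in>galG e q m M. \<forall>x\<in>splitE e q m M. \<tau> (g x) = g (\<sigma> x)) \<and>
              (\<exists>k. orth_transvection e (Qform e q m M) (rootsL e q m M) (\<tau> ^^ k)))"
proof -
  obtain s where s: "q = 2 ^ s" using q_pow2 by blast
  have monic: "lead_coeff M = 1" using selfrec by (simp add: self_reciprocal_def)
  interpret frobenius_setup M q s m e
    using q_card s m_ge deg monic const1 emb algclosed by unfold_locales
  obtain h where h: "subfield_hom (splitE e q m M) h" "\<And>P. h (\<pi> P) = \<iota> P"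
    using ex_embedding by blast
  interpret frobenius_lift M q s m e h
    by (intro frobenius_lift.intro frobenius_setup_axioms h(1)) (unfold_locales, rule h(2))
  have "M = reflect_poly M" using selfrec const1 by (simp add: self_reciprocal_def)
  then have "coeff M n = coeff M (2 * m - n)" if "n \<le> 2 * m" for n
    using coeff_reflect_poly[of M n] deg that by simp
  then have sym: "coeff M (m + j) = coeff M (m - j)" if "j \<le> m" for j
    using that by (metis add_le_mono diff_diff_add le_refl mult_2 add_diff_cancel_left')
  have "M \<noteq> 0" using const1 by auto
  \<comment> \<open>In \<open>M(1) = 0\<close> the symmetric coefficients cancel in pairs in
    characteristic two, which leaves the middle one.\<close>
  then have "poly M 1 = 0" using mult2 by (simp add: order_root)
  then have "(\<Sum>i\<le>2 * m. coeff M i) = 0" by (simp add: poly_altdef deg)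
  then have "coeff M m + (\<Sum>j=1..m. 2 * coeff M (m - j)) = 0"
    unfolding sum_symmetric_split by (simp add: sym)
  then have mid: "coeff M m = 0" by (simp add: char_base)
  obtain k where k: "{w ^ (q ^ k) - w | w. lin M w = 0} = range \<epsilon>"
    using image_frobenius_power_minus_id[of M] algclosed const1 mult2 simple unfolding e_comp by auto
  have "Qform e q m M v \<in> range \<epsilon>" if "v \<in> rootsL e q m M" for v
    using Qform_in_range[OF fpoly_spec[OF char_base s s_pos power_q deg sym mid] that] .
  then have "orth_transvection e (Qform e q m M) (rootsL e q m M) (\<sigma> ^^ k)"
    by (intro orth_transvection_\<sigma>_power k)
  then have "\<exists>k. orth_transvection e (Qform e q m M) (rootsL e q m M) (\<sigma> ^^ k)" by blast
  \<comment> \<open>The required member of the Frobenius class is \<open>\<sigma>\<close> itself,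
    conjugate to itself by the identity.\<close>
  moreover have "\<exists>g\<in>galG e q m M. \<forall>x\<in>splitE e q m M. \<sigma> (g x) = g (\<sigma> x)"
    using id_galG by (intro bexI[of _ id]) auto
  ultimately show ?thesis
    using prime_above_J frobenius_at_J \<sigma>_galG by blast
qed

end
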